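(* Let $G$ be a connected digraph, $X \subseteq V(G)$ connected and $L$ a list-assignment of $G$ such that $G-X$ is $L$-dicolourable, $G$ is not $L$-dicolourable and $\forall x \in X, \lvert L(x)\rvert \ge d_{\max}(x)$. Then $G[X]$ is a directed Gallai forest.
   Context: A list assignment of $G$ maps each vertex $v$ to a set $L(v)$ of colours; an $L$-dicolouring is an assignment $\phi(v)\in L(v)$ such that each colour class induces an acyclic subdigraph. $X$ connected means $G[X]$ is (weakly) connected. $d_{\max}(x)=\max(d^+(x),d^-(x))$ in $G$. A directed Gallai tree is a connected digraph whose blocks (maximal non-separable subdigraphs) are each a single arc, a directed cycle, a symmetric odd cycle, or a complete symmetric digraph; a directed Gallai forest is a digraph whose connected components are directed Gallai trees. *)

theory Defs
  imports "Graph_Theory.Digraph_Component" "Graph_Theory.Kuratowski"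
begin

text \<open>
  A digraph is the locale predicate \<open>digraph\<close>: finite, no loops, no parallel arcs;
  a pair of opposite arcs is allowed. The library's \<open>connected\<close> is weak
  connectedness and excludes the null digraph.
\<close>

subsection \<open>Dicolourings\<close>

text \<open>The library's \<open>cycle\<close> is a directed cycle; a pair of opposite arcs is one.\<close>

definition acyclic_digraph :: "('a, 'b) pre_digraph \<Rightarrow> bool" where
  "acyclic_digraph G \<longleftrightarrow> \<not> (\<exists>p. pre_digraph.cycle G p)"

definition list_dicolouring ::
    "('a, 'b) pre_digraph \<Rightarrow> ('a \<Rightarrow> 'c set) \<Rightarrow> ('a \<Rightarrow> 'c) \<Rightarrow> bool" where
  "list_dicolouring G L \<phi> \<longleftrightarrow>
     (\<forall>v \<in> verts G. \<phi> v \<in> L v) \<and>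
     (\<forall>c. acyclic_digraph (G \<restriction> {v \<in> verts G. \<phi> v = c}))"

definition list_dicolourable :: "('a, 'b) pre_digraph \<Rightarrow> ('a \<Rightarrow> 'c set) \<Rightarrow> bool" where
  "list_dicolourable G L \<longleftrightarrow> (\<exists>\<phi>. list_dicolouring G L \<phi>)"

definition d_max :: "('a, 'b) pre_digraph \<Rightarrow> 'a \<Rightarrow> nat" where
  "d_max G x = max (out_degree G x) (in_degree G x)"

subsection \<open>Blocks\<close>

definition cut_vertex :: "('a, 'b) pre_digraph \<Rightarrow> 'a \<Rightarrow> bool" where
  "cut_vertex G v \<longleftrightarrow>
     v \<in> verts G \<and> verts G \<noteq> {v} \<and> \<not> connected (pre_digraph.del_vert G v)"

definition nonseparable :: "('a, 'b) pre_digraph \<Rightarrow> bool" where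
  "nonseparable G \<longleftrightarrow> connected G \<and> (\<forall>v. \<not> cut_vertex G v)"

definition is_block :: "('a, 'b) pre_digraph \<Rightarrow> ('a, 'b) pre_digraph \<Rightarrow> bool" where
  "is_block B G \<longleftrightarrow> pre_digraph.max_subgraph G nonseparable B"

definition is_component :: "('a, 'b) pre_digraph \<Rightarrow> ('a, 'b) pre_digraph \<Rightarrow> bool" where
  "is_component C G \<longleftrightarrow> pre_digraph.max_subgraph G connected C"

subsection \<open>Directed Gallai trees and forests\<close>

definition single_arc :: "('a, 'b) pre_digraph \<Rightarrow> bool" where
  "single_arc B \<longleftrightarrow> digraph B \<and> (\<exists>e. arcs B = {e} \<and> verts B = {tail B e, head B e})"

definition directed_cycle :: "('a, 'b) pre_digraph \<Rightarrow> bool" where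
  "directed_cycle B \<longleftrightarrow> digraph B \<and>
     (\<exists>p. pre_digraph.cycle B p \<and> arcs B = set p \<and> verts B = tail B ` set p)"

definition symmetric_odd_cycle :: "('a, 'b) pre_digraph \<Rightarrow> bool" where
  "symmetric_odd_cycle B \<longleftrightarrow> digraph B \<and>
     (\<exists>vs. distinct vs \<and> odd (length vs) \<and> 3 \<le> length vs \<and> verts B = set vs \<and>
        arcs_ends B = (\<Union>i < length vs.
          {(vs ! i, vs ! (Suc i mod length vs)), (vs ! (Suc i mod length vs), vs ! i)}))"

text \<open>The one-vertex digraph counts as complete symmetric (\<open>n = 1\<close>); it is the only
  block of a one-vertex directed Gallai tree.\<close>

definition complete_symmetric :: "('a, 'b) pre_digraph \<Rightarrow> bool" where
  "complete_symmetric B \<longleftrightarrow> (\<exists>n. complete_digraph n B)"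

definition directed_gallai_tree :: "('a, 'b) pre_digraph \<Rightarrow> bool" where
  "directed_gallai_tree T \<longleftrightarrow> digraph T \<and> connected T \<and>
     (\<forall>B. is_block B T \<longrightarrow>
        single_arc B \<or> directed_cycle B \<or> symmetric_odd_cycle B \<or> complete_symmetric B)"

definition directed_gallai_forest :: "('a, 'b) pre_digraph \<Rightarrow> bool" where
  "directed_gallai_forest F \<longleftrightarrow> digraph F \<and>
     (\<forall>C. is_component C F \<longrightarrow> directed_gallai_tree C)"

end

theory Submission
  imports Defs "HOL-Combinatorics.Orbits"
begin

text \<open>
  Colouring the vertices of a connected \<open>Y \<subseteq> X\<close> greedily towards a root shows that any dicolouring
  of \<open>G - Y\<close> extends to all of \<open>G\<close> but the root, so at the root every colour of the list
  occurs exactly once among the out-neighbours and exactly once among the in-neighbours. Hence, for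
  each \<open>x \<in> Y\<close>, the set of colours not used on out-neighbours of \<open>x\<close> outside \<open>Y\<close> has exactly as
  many elements as \<open>x\<close> has out-neighbours in \<open>Y\<close>, and dually for in-neighbours.

  If \<open>Y\<close> is nonseparable, colouring a single vertex and comparing shows that all nonempty sets of
  this kind coincide with one set \<open>S\<close>; so in \<open>G[Y]\<close> all in- and out-degrees are \<open>0\<close> or
  \<open>r = |S|\<close>, and \<open>G[Y]\<close> is not bipartite when \<open>r \<ge> 2\<close>, as two colours of \<open>S\<close> would then suffice.
  For \<open>r = 1\<close> this is a directed cycle. For \<open>r \<ge> 2\<close>, induct on \<open>|Y|\<close> and look at \<open>G[Y - v]\<close>, whose
  blocks are single arcs or regular. If it is one block, \<open>G[Y]\<close> is complete. Otherwise its end blocks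
  compete for the \<open>r\<close> out- and in-neighbours of \<open>v\<close>, which forces \<open>r = 2\<close> and, propagating along
  edges, a symmetric cycle, necessarily odd.
\<close>

section \<open>Connected and nonseparable vertex sets\<close>

abbreviation adj :: "('a \<times> 'a) set \<Rightarrow> 'a \<Rightarrow> 'a \<Rightarrow> bool" where
  "adj E x y \<equiv> (x, y) \<in> E \<or> (y, x) \<in> E"

text \<open>Connectedness by cuts rather than by paths: the arguments below mostly need an arc
  leaving a given set, and the form does not change when all arcs are reversed.\<close>

definition connected_set :: "('a \<times> 'a) set \<Rightarrow> 'a set \<Rightarrow> bool" where
  "connected_set E Y \<longleftrightarrow> Y \<noteq> {} \<and>
     (\<forall>A. A \<subset> Y \<longrightarrow> A \<noteq> {} \<longrightarrow> (\<exists>x \<in> A. \<exists>y \<in> Y - A. adj E x y))"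

text \<open>Singletons count as nonseparable; the guard \<open>Y \<noteq> {v}\<close> is there
  because the empty set is not connected.\<close>

definition nonseparable_set :: "('a \<times> 'a) set \<Rightarrow> 'a set \<Rightarrow> bool" where
  "nonseparable_set E Y \<longleftrightarrow>
     connected_set E Y \<and> (\<forall>v \<in> Y. Y \<noteq> {v} \<longrightarrow> connected_set E (Y - {v}))"

lemma connected_setI:
  assumes "Y \<noteq> {}"
    and "\<And>A. A \<subset> Y \<Longrightarrow> A \<noteq> {} \<Longrightarrow> \<exists>x \<in> A. \<exists>y \<in> Y - A. adj E x y"
  shows "connected_set E Y"
  using assms by (auto simp: connected_set_def)

lemma connected_set_crossing:
  assumes "connected_set E Y" "A \<subseteq> Y" "A \<noteq> {}" "A \<noteq> Y"
  obtains x y where "x \<in> A" "y \<in> Y" "y \<notin> A" "adj E x y"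
proof -
  have "A \<subset> Y" using assms by blast
  then have "\<exists>x \<in> A. \<exists>y \<in> Y - A. adj E x y"
    using assms unfolding connected_set_def by simp
  then show ?thesis using that by blast
qed

lemma connected_set_nonempty: "connected_set E Y \<Longrightarrow> Y \<noteq> {}"
  by (simp add: connected_set_def)

lemma connected_set_converse [simp]: "connected_set (E\<inverse>) Y \<longleftrightarrow> connected_set E Y"
  by (auto simp: connected_set_def disj_commute)

lemma nonseparable_set_converse [simp]: "nonseparable_set (E\<inverse>) Y \<longleftrightarrow> nonseparable_set E Y"
  by (simp add: nonseparable_set_def)

text \<open>The vertices satisfying \<open>P\<close> cannot form a proper part of \<open>Y\<close>:
  an arc would cross its boundary, against \<open>step\<close>.\<close>

lemma connected_set_induct [consumes 3, case_names step]:
  assumes "connected_set E Y" "P x" "x \<in> Y"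
    and step: "\<And>x y. x \<in> Y \<Longrightarrow> y \<in> Y \<Longrightarrow> P x \<Longrightarrow> adj E x y \<Longrightarrow> P y"
    and "y \<in> Y"
  shows "P y"
proof (rule ccontr)
  assume "\<not> P y"
  then have "{z \<in> Y. P z} \<subseteq> Y" "{z \<in> Y. P z} \<noteq> {}" "{z \<in> Y. P z} \<noteq> Y"
    using assms(2,3,5) by blast+
  then obtain u v where "u \<in> {z \<in> Y. P z}" "v \<in> Y" "v \<notin> {z \<in> Y. P z}" "adj E u v"
    by (rule connected_set_crossing[OF assms(1)])
  then show False using step[of u v] by blast
qed

lemma nonseparable_set_connected: "nonseparable_set E Y \<Longrightarrow> connected_set E Y"
  by (simp add: nonseparable_set_def)

lemma nonseparable_set_delete:
  "nonseparable_set E Y \<Longrightarrow> v \<in> Y \<Longrightarrow> Y \<noteq> {v} \<Longrightarrow> connected_set E (Y - {v})"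
  by (auto simp: nonseparable_set_def)

lemma connected_set_neighbour:
  assumes "connected_set E Y" "x \<in> Y" "Y \<noteq> {x}"
  obtains y where "y \<in> Y" "y \<noteq> x" "adj E x y"
  using connected_set_crossing[OF assms(1), of "{x}"] assms by auto

text \<open>After deletion of a first neighbour \<open>y\<close>, the vertex \<open>x\<close> still
  has a neighbour in the connected rest.\<close>

lemma nonseparable_set_two_neighbours:
  assumes "nonseparable_set E Y" "finite Y" "3 \<le> card Y" "x \<in> Y"
  obtains y z where "y \<in> Y" "z \<in> Y" "y \<noteq> x" "z \<noteq> x" "y \<noteq> z" "adj E x y" "adj E x z"
proof -
  have "Y \<noteq> {x}" using assms by auto
  then obtain y where y: "y \<in> Y" "y \<noteq> x" "adj E x y"
    using connected_set_neighbour nonseparable_set_connected assms by metis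
  have "Y \<noteq> {y}" "Y \<noteq> {x, y}" using assms y by (auto simp: card_insert_if)
  then have "connected_set E (Y - {y})" "Y - {y} \<noteq> {x}" "x \<in> Y - {y}"
    using nonseparable_set_delete[OF assms(1) y(1)] assms(4) y by auto
  then obtain z where "z \<in> Y - {y}" "z \<noteq> x" "adj E x z"
    using connected_set_neighbour by metis
  then show ?thesis using that y by auto
qed

section \<open>End blocks of a connected vertex set\<close>

definition end_block :: "('a \<times> 'a) set \<Rightarrow> 'a set \<Rightarrow> 'a set \<Rightarrow> 'a \<Rightarrow> bool" where
  "end_block E Z K d \<longleftrightarrow> K \<subseteq> Z \<and> K \<noteq> {} \<and> d \<in> Z \<and> d \<notin> K \<and> nonseparable_set E (insert d K) \<and>
     (\<forall>x \<in> K. \<forall>y \<in> Z. adj E x y \<longrightarrow> y \<in> insert d K)"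

text \<open>A smallest set \<open>K\<close> attached to the rest of \<open>Z\<close> at a single vertex \<open>d\<close> yields an end
  block \<open>insert d K\<close> with cut vertex \<open>d\<close>.\<close>

lemma end_block_exists:
  assumes "finite Z" "connected_set E Z" "c \<in> Z" "A \<subseteq> Z - {c}" "A \<noteq> {}"
    and "\<forall>x \<in> A. \<forall>y \<in> Z. adj E x y \<longrightarrow> y \<in> insert c A"
  obtains K d where "K \<subseteq> A" "end_block E Z K d"
proof -
  \<comment> \<open>\<open>Q\<close> leaves nonseparability out: it will follow from the minimality
    of \<open>card K\<close>.\<close>
  define Q where "Q = (\<lambda>K d. K \<subseteq> A \<and> K \<noteq> {} \<and> d \<in> Z \<and> d \<notin> K \<and>
    (\<forall>x y. x \<in> K \<longrightarrow> y \<in> Z \<longrightarrow> adj E x y \<longrightarrow> y \<in> insert d K))"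
  have "Q A c" using assms unfolding Q_def by blast
  then have "\<exists>Kd. Q (fst Kd) (snd Kd)" by (metis fst_conv snd_conv)
  then obtain Kd where Kd: "Q (fst Kd) (snd Kd)"
    and minKd: "\<And>Kd'. Q (fst Kd') (snd Kd') \<Longrightarrow> card (fst Kd) \<le> card (fst Kd')"
    using ex_has_least_nat[of "\<lambda>p. Q (fst p) (snd p)" _ "\<lambda>p. card (fst p)"] by metis
  define K d where "K = fst Kd" and "d = snd Kd"
  have Q: "Q K d" and min: "\<And>K' d'. Q K' d' \<Longrightarrow> card K \<le> card K'"
    using Kd minKd[of "(_, _)"] by (auto simp: K_def d_def)
  have K: "K \<subseteq> A" "K \<noteq> {}" "d \<in> Z" "d \<notin> K" and
    nb: "\<And>x y. x \<in> K \<Longrightarrow> y \<in> Z \<Longrightarrow> adj E x y \<Longrightarrow> y \<in> insert d K"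
    using Q unfolding Q_def by auto
  have KZ: "K \<subseteq> Z" using K assms by blast
  have finK: "finite K" using KZ assms finite_subset by blast
  \<comment> \<open>If deleting \<open>e\<close> disconnects \<open>insert d K\<close>, the side
    \<open>P'\<close> avoiding \<open>d\<close> is attached to the rest of \<open>Z\<close> at
    \<open>e\<close> alone and is smaller than \<open>K\<close>.\<close>
  have crossing: "\<exists>x \<in> P. \<exists>y \<in> W - P. adj E x y"
    if "e \<in> insert d K" "W = insert d K - {e}" "P \<subset> W" "P \<noteq> {}" for e W P
  proof (rule ccontr)
    assume no: "\<not> (\<exists>x \<in> P. \<exists>y \<in> W - P. adj E x y)"
    define P' where "P' = (if d \<in> P then W - P else P)"
    have P': "P' \<subseteq> K" "P' \<noteq> {}" "P' \<subseteq> W" using that by (auto simp: P'_def)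
    have no': "\<not> (\<exists>x \<in> P'. \<exists>y \<in> W - P'. adj E x y)"
      using no that(3) by (auto simp: P'_def)
    have "P' \<noteq> K"
    proof
      assume "P' = K"
      then have "d \<in> P \<Longrightarrow> False" "P = K"
        using that K by (auto simp: P'_def split: if_splits)
      then show False using that K by auto
    qed
    then have "card P' < card K" using P' finK by (simp add: psubset_card_mono psubset_eq)
    moreover have "Q P' e"
    proof -
      have "P' \<subseteq> A" "e \<in> Z" "e \<notin> P'"
        using P' K KZ that(1,2) by blast+
      moreover have "y \<in> insert e P'" if "x \<in> P'" "y \<in> Z" "adj E x y" for x y
      proof -
        have "x \<in> K" using P'(1) that(1) by blast
        then have "y \<in> insert d K" using nb that(2,3) by blast
        then have "y = e \<or> y \<in> W" using \<open>W = _\<close> by blast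
        then show ?thesis using no' that(1,3) by blast
      qed
      ultimately show ?thesis using P'(2) unfolding Q_def by blast
    qed
    ultimately show False using min[of P' e] by simp
  qed
  \<comment> \<open>Here the side \<open>P'\<close> avoiding \<open>d\<close> would have no arc to
    the rest of \<open>Z\<close> at all, although \<open>Z\<close> is connected.\<close>
  have "connected_set E (insert d K)"
  proof (rule connected_setI)
    fix P assume P: "P \<subset> insert d K" "P \<noteq> {}"
    show "\<exists>x \<in> P. \<exists>y \<in> insert d K - P. adj E x y"
    proof (rule ccontr)
      assume no: "\<not> (\<exists>x \<in> P. \<exists>y \<in> insert d K - P. adj E x y)"
      define P' where "P' = (if d \<in> P then insert d K - P else P)"
      have P': "P' \<subseteq> K" "P' \<noteq> {}" using P by (auto simp: P'_def)
      have no': "\<not> (\<exists>x \<in> P'. \<exists>y \<in> insert d K - P'. adj E x y)"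
        using no P by (auto simp: P'_def)
      have "P' \<subseteq> Z" "P' \<noteq> Z" using P' K KZ by blast+
      then obtain x y where "x \<in> P'" "y \<in> Z" "y \<notin> P'" "adj E x y"
        using connected_set_crossing[OF assms(2) _ P'(2)] by metis
      moreover from this have "y \<in> insert d K" using nb P' by blast
      ultimately show False using no' by blast
    qed
  qed simp
  moreover have "connected_set E (insert d K - {e})" if "e \<in> insert d K" "insert d K \<noteq> {e}" for e
  proof (rule connected_setI)
    show "insert d K - {e} \<noteq> {}" using that by blast
  qed (rule crossing[OF that(1) refl])
  ultimately have "nonseparable_set E (insert d K)"
    by (simp add: nonseparable_set_def)
  then have "end_block E Z K d"
    using K KZ nb by (simp add: end_block_def)
  then show ?thesis using that K(1) by blast
qed

text \<open>A cut vertex \<open>c\<close> splits \<open>Z - {c}\<close> into two sides with no arc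
  between them; each side contains the part \<open>K\<close> of an end block.\<close>

lemma two_end_blocks:
  assumes "finite Z" "connected_set E Z" "\<not> nonseparable_set E Z"
  obtains K1 d1 K2 d2 where "K1 \<inter> K2 = {}" "end_block E Z K1 d1" "end_block E Z K2 d2"
proof -
  obtain c where c: "c \<in> Z" "Z \<noteq> {c}" "\<not> connected_set E (Z - {c})"
    using assms by (auto simp: nonseparable_set_def)
  then have "Z - {c} \<noteq> {}" by blast
  then obtain A where A: "A \<subset> Z - {c}" "A \<noteq> {}" and no: "\<not> (\<exists>x \<in> A. \<exists>y \<in> Z - {c} - A. adj E x y)"
    using connected_setI[of "Z - {c}" E] c(3) by metis
  have "A \<subseteq> Z - {c}" "\<forall>x \<in> A. \<forall>y \<in> Z. adj E x y \<longrightarrow> y \<in> insert c A"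
    using A no by blast+
  then obtain K1 d1 where 1: "K1 \<subseteq> A" "end_block E Z K1 d1"
    using end_block_exists[OF assms(1,2) c(1) _ A(2)] by metis
  have "Z - {c} - A \<subseteq> Z - {c}" "Z - {c} - A \<noteq> {}"
    "\<forall>x \<in> Z - {c} - A. \<forall>y \<in> Z. adj E x y \<longrightarrow> y \<in> insert c (Z - {c} - A)"
    using A no by blast+
  then obtain K2 d2 where 2: "K2 \<subseteq> Z - {c} - A" "end_block E Z K2 d2"
    using end_block_exists[OF assms(1,2) c(1)] by metis
  have "K1 \<inter> K2 = {}" using 1 2 by blast
  then show ?thesis using that 1 2 by blast
qed

section \<open>Extending partial dicolourings\<close>

text \<open>Treats all colour classes in one relation, which is acyclic iff each class is, as
  \<open>acyclic_mono_arcs_iff\<close> shows.\<close>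

definition mono_arcs :: "('a \<times> 'a) set \<Rightarrow> ('a \<Rightarrow> 'c) \<Rightarrow> 'a set \<Rightarrow> ('a \<times> 'a) set" where
  "mono_arcs E \<phi> C = {(u, v) \<in> E. u \<in> C \<and> v \<in> C \<and> \<phi> u = \<phi> v}"

definition dicolouring_on ::
    "('a \<times> 'a) set \<Rightarrow> ('a \<Rightarrow> 'c set) \<Rightarrow> 'a set \<Rightarrow> ('a \<Rightarrow> 'c) \<Rightarrow> bool" where
  "dicolouring_on E L C \<phi> \<longleftrightarrow> (\<forall>v \<in> C. \<phi> v \<in> L v) \<and> acyclic (mono_arcs E \<phi> C)"

lemma mono_arcs_converse: "mono_arcs (E\<inverse>) \<phi> C = (mono_arcs E \<phi> C)\<inverse>"
  by (auto simp: mono_arcs_def)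

lemma dicolouring_on_converse [simp]: "dicolouring_on (E\<inverse>) L C \<phi> \<longleftrightarrow> dicolouring_on E L C \<phi>"
  by (simp add: dicolouring_on_def mono_arcs_converse acyclic_converse)

text \<open>No arc leaves \<open>x\<close>, so a closed walk cannot pass through it.\<close>

lemma acyclic_sink:
  assumes "\<And>y. (x, y) \<notin> R" and "acyclic {(u, v) \<in> R. u \<noteq> x \<and> v \<noteq> x}"
  shows "acyclic R"
proof -
  let ?R' = "{(u, v) \<in> R. u \<noteq> x \<and> v \<noteq> x}"
  have avoid: "(a, b) \<in> R\<^sup>+ \<Longrightarrow> b \<noteq> x \<Longrightarrow> (a, b) \<in> ?R'\<^sup>+" for a b
  proof (induction rule: trancl_induct)
    case (base y)
    then show ?case using assms(1) by blast
  next
    case (step y z)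
    then have "(a, y) \<in> ?R'\<^sup>+" "(y, z) \<in> ?R'" using assms(1) by blast+
    then show ?case by (rule trancl_into_trancl)
  qed
  have "(a, a) \<notin> R\<^sup>+" for a
  proof
    assume "(a, a) \<in> R\<^sup>+"
    moreover from this have "a \<noteq> x" using assms(1) by (blast dest: tranclD)
    ultimately have "(a, a) \<in> ?R'\<^sup>+" by (rule avoid)
    then show False using assms(2) by (simp add: acyclic_def)
  qed
  then show ?thesis by (simp add: acyclic_def)
qed

text \<open>A colour missing among the coloured out-neighbours makes \<open>x\<close> a sink of its
  colour class, whatever colours its in-neighbours have.\<close>

lemma dicolouring_on_insert_out:
  assumes "dicolouring_on E L C \<phi>" "x \<notin> C" "(x, x) \<notin> E" "a \<in> L x"
    and "\<And>y. y \<in> C \<Longrightarrow> (x, y) \<in> E \<Longrightarrow> \<phi> y \<noteq> a"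
  shows "dicolouring_on E L (insert x C) (\<phi>(x := a))"
proof -
  let ?R = "mono_arcs E (\<phi>(x := a)) (insert x C)"
  have "{(u, v) \<in> ?R. u \<noteq> x \<and> v \<noteq> x} \<subseteq> mono_arcs E \<phi> C"
    by (auto simp: mono_arcs_def)
  moreover have "acyclic (mono_arcs E \<phi> C)" using assms by (simp add: dicolouring_on_def)
  ultimately have "acyclic {(u, v) \<in> ?R. u \<noteq> x \<and> v \<noteq> x}" by (rule acyclic_subset[rotated])
  moreover have "(x, y) \<notin> ?R" for y
    using assms by (auto simp: mono_arcs_def)
  ultimately have "acyclic ?R" by (rule acyclic_sink[rotated])
  then show ?thesis using assms by (auto simp: dicolouring_on_def)
qed

lemma dicolouring_on_insert_in:
  assumes "dicolouring_on E L C \<phi>" "x \<notin> C" "(x, x) \<notin> E" "a \<in> L x"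
    and "\<And>y. y \<in> C \<Longrightarrow> (y, x) \<in> E \<Longrightarrow> \<phi> y \<noteq> a"
  shows "dicolouring_on E L (insert x C) (\<phi>(x := a))"
  using dicolouring_on_insert_out[of "E\<inverse>" L C \<phi> x a] assms by simp

text \<open>The degree and colouring hypotheses in a form symmetric under reversal of arcs, so that
  \<open>converse\<close> turns each result on out-neighbours into one on in-neighbours. The guard
  \<open>finite (L x)\<close> is there because \<open>card\<close> of an infinite set is
  \<open>0\<close>.\<close>

locale uncolourable =
  fixes E :: "('a \<times> 'a) set" and V :: "'a set" and L :: "'a \<Rightarrow> 'c set" and X :: "'a set"
  assumes finite_V: "finite V" and arcs_in_V: "E \<subseteq> V \<times> V" and loopless: "(x, x) \<notin> E"
    and X_in_V: "X \<subseteq> V"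
    and no_dicolouring: "\<not> dicolouring_on E L V \<phi>"
    and out_deg: "x \<in> X \<Longrightarrow> finite (L x) \<Longrightarrow> card (E `` {x}) \<le> card (L x)"
    and in_deg: "x \<in> X \<Longrightarrow> finite (L x) \<Longrightarrow> card (E\<inverse> `` {x}) \<le> card (L x)"
begin

lemma converse: "uncolourable (E\<inverse>) V L X"
  by unfold_locales
    (use finite_V arcs_in_V loopless X_in_V no_dicolouring out_deg in_deg in auto)

lemma finite_nbrs: "finite (E `` {x})"
  by (rule finite_subset[OF _ finite_V]) (use arcs_in_V in auto)

text \<open>The uncoloured out-neighbour \<open>z\<close> makes the coloured out-neighbours of
  \<open>x\<close> fewer than the colours in \<open>L x\<close>.\<close>

lemma free_colour:
  assumes "x \<in> X" "(x, z) \<in> E" "z \<notin> C"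
  obtains a where "a \<in> L x" "\<And>y. y \<in> C \<Longrightarrow> (x, y) \<in> E \<Longrightarrow> \<phi> y \<noteq> a"
proof -
  have "\<not> L x \<subseteq> \<phi> ` (E `` {x} \<inter> C)"
  proof
    assume sub: "L x \<subseteq> \<phi> ` (E `` {x} \<inter> C)"
    have fin: "finite (E `` {x} \<inter> C)" using finite_nbrs by blast
    then have "finite (L x)" using sub finite_surj by blast
    then have "card (E `` {x}) \<le> card (L x)" using out_deg assms by blast
    also have "\<dots> \<le> card (E `` {x} \<inter> C)" using surj_card_le[OF fin sub] .
    also have "\<dots> < card (E `` {x})"
      by (rule psubset_card_mono[OF finite_nbrs]) (use assms in blast)
    finally show False by simp
  qed
  then show ?thesis using that by blast
qed

text \<open>It suffices to avoid the colours on one side: that of the out-neighbours if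
  \<open>z\<close> is one of them, that of the in-neighbours otherwise.\<close>

lemma extend_at:
  assumes "dicolouring_on E L C \<phi>" "x \<in> X" "x \<notin> C" "adj E x z" "z \<notin> C"
  obtains a where "dicolouring_on E L (insert x C) (\<phi>(x := a))"
proof (cases "(x, z) \<in> E")
  case True
  then obtain a where "a \<in> L x" "\<And>y. y \<in> C \<Longrightarrow> (x, y) \<in> E \<Longrightarrow> \<phi> y \<noteq> a"
    using free_colour[OF assms(2) _ assms(5)] by metis
  then show ?thesis using that dicolouring_on_insert_out[OF assms(1,3) loopless] by metis
next
  case False
  interpret conv: uncolourable "E\<inverse>" V L X by (rule converse)
  have "(x, z) \<in> E\<inverse>" using assms False by blast
  then obtain a where "a \<in> L x" "\<And>y. y \<in> C \<Longrightarrow> (y, x) \<in> E \<Longrightarrow> \<phi> y \<noteq> a"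
    using conv.free_colour[OF assms(2) _ assms(5)] by (metis converse_iff)
  then show ?thesis using that dicolouring_on_insert_in[OF assms(1,3) loopless] by metis
qed

text \<open>The induction adds to \<open>Z\<close> a vertex \<open>y\<close> adjacent to it; when \<open>y\<close> is finally coloured, its
  neighbour in \<open>Z\<close> is still uncoloured, which leaves it a free colour.\<close>

lemma dicolouring_on_grow:
  assumes "connected_set E Y" "Y \<subseteq> X" "dicolouring_on E L (V - Y) \<phi>" "Z \<subseteq> Y" "Z \<noteq> {}"
  obtains \<psi> where "dicolouring_on E L (V - Z) \<psi>" "\<And>v. v \<in> V - Y \<Longrightarrow> \<psi> v = \<phi> v"
proof -
  have finY: "finite Y" using assms X_in_V finite_V by (meson finite_subset)
  have "\<exists>\<psi>. dicolouring_on E L (V - Z) \<psi> \<and> (\<forall>v \<in> V - Y. \<psi> v = \<phi> v)"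
    using assms(4,5)
  proof (induction "card (Y - Z)" arbitrary: Z rule: less_induct)
    case less
    show ?case
    proof (cases "Z = Y")
      case True
      then show ?thesis using assms by blast
    next
      case False
      obtain z y where zy: "z \<in> Z" "y \<in> Y" "y \<notin> Z" "adj E z y"
        using connected_set_crossing[OF assms(1) less.prems(1,2) False] .
      have "Y - insert y Z \<subset> Y - Z" using zy by blast
      then have "card (Y - insert y Z) < card (Y - Z)"
        using finY by (simp add: psubset_card_mono)
      moreover have "insert y Z \<subseteq> Y" "insert y Z \<noteq> {}" using less zy by auto
      ultimately obtain \<psi> where \<psi>: "dicolouring_on E L (V - insert y Z) \<psi>"
        "\<forall>v \<in> V - Y. \<psi> v = \<phi> v"
        using less.hyps by metis
      have "y \<in> X" "adj E y z" "y \<notin> V - insert y Z" "z \<notin> V - insert y Z"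
        using zy assms by auto
      then obtain a where
        "dicolouring_on E L (insert y (V - insert y Z)) (\<psi>(y := a))"
        using extend_at[OF \<psi>(1)] by metis
      moreover have "insert y (V - insert y Z) = V - Z" using zy assms X_in_V by blast
      ultimately show ?thesis using \<psi>(2) zy by (intro exI[of _ "\<psi>(y := a)"]) auto
    qed
  qed
  then show ?thesis using that by blast
qed

text \<open>A colour of \<open>L r\<close> missing on the out-neighbours would complete the
  dicolouring. So they show all of \<open>L r\<close>, and there are at most
  \<open>card (L r)\<close> of them, which forces a bijection.\<close>

lemma tight_at:
  assumes "r \<in> X" "dicolouring_on E L (V - {r}) \<psi>"
  shows "inj_on \<psi> (E `` {r})" "\<psi> ` (E `` {r}) = L r"
proof -
  have sub: "L r \<subseteq> \<psi> ` (E `` {r})"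
  proof
    fix a assume a: "a \<in> L r"
    show "a \<in> \<psi> ` (E `` {r})"
    proof (rule ccontr)
      assume "a \<notin> \<psi> ` (E `` {r})"
      then have "dicolouring_on E L (insert r (V - {r})) (\<psi>(r := a))"
        by (intro dicolouring_on_insert_out assms loopless a) auto
      moreover have "insert r (V - {r}) = V" using assms X_in_V by blast
      ultimately show False using no_dicolouring by simp
    qed
  qed
  then have "finite (L r)" using finite_nbrs finite_surj by blast
  then have le: "card (E `` {r}) \<le> card (L r)" using out_deg assms by blast
  also have "\<dots> \<le> card (\<psi> ` (E `` {r}))" using sub finite_nbrs by (simp add: card_mono)
  finally have "card (\<psi> ` (E `` {r})) = card (E `` {r})"
    using card_image_le[OF finite_nbrs, of \<psi> r] by simp
  then show "inj_on \<psi> (E `` {r})" using finite_nbrs by (simp add: inj_on_iff_eq_card)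
  show "\<psi> ` (E `` {r}) = L r"
    using sub le card_image_le[OF finite_nbrs, of \<psi> r] finite_nbrs
    by (intro card_seteq[symmetric]) auto
qed

text \<open>Extend \<open>\<phi>\<close> to all vertices but \<open>x\<close>, keeping it outside
  \<open>Y\<close>, and restrict the bijection of \<open>tight_at\<close> to the out-neighbours
  outside \<open>Y\<close>.\<close>

lemma outside_colours:
  assumes "connected_set E Y" "Y \<subseteq> X" "dicolouring_on E L (V - Y) \<phi>" "x \<in> Y"
  shows "inj_on \<phi> (E `` {x} - Y)" "\<phi> ` (E `` {x} - Y) \<subseteq> L x" "finite (L x)"
    "card (L x) = card (E `` {x})"
proof -
  have "{x} \<subseteq> Y" "{x} \<noteq> {}" "x \<in> X" using assms by auto
  then obtain \<psi> where \<psi>: "dicolouring_on E L (V - {x}) \<psi>" "\<And>v. v \<in> V - Y \<Longrightarrow> \<psi> v = \<phi> v"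
    using dicolouring_on_grow[OF assms(1-3), of "{x}"] by metis
  note t = tight_at[OF \<open>x \<in> X\<close> \<psi>(1)]
  have eq: "\<psi> v = \<phi> v" if "v \<in> E `` {x} - Y" for v using that \<psi>(2) arcs_in_V by blast
  show "inj_on \<phi> (E `` {x} - Y)"
    using inj_on_subset[OF t(1), of "E `` {x} - Y"] inj_on_cong[of "E `` {x} - Y" \<psi> \<phi>] eq
    by simp
  have "\<phi> ` (E `` {x} - Y) = \<psi> ` (E `` {x} - Y)" using eq by force
  then show "\<phi> ` (E `` {x} - Y) \<subseteq> L x" using t(2) by blast
  show "finite (L x)" using t(2) finite_nbrs by (metis finite_imageI)
  show "card (L x) = card (E `` {x})" using t card_image by metis
qed

end

section \<open>Available colours; the in-neighbour version is \<open>avail\<close> for the converse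
  relation\<close>

definition avail ::
    "('a \<times> 'a) set \<Rightarrow> ('a \<Rightarrow> 'c set) \<Rightarrow> ('a \<Rightarrow> 'c) \<Rightarrow> 'a set \<Rightarrow> 'a \<Rightarrow> 'c set" where
  "avail E L \<phi> Y x = L x - \<phi> ` (E `` {x} - Y)"

context uncolourable
begin

text \<open>The outer out-neighbours of \<open>x\<close> carry pairwise distinct colours of
  \<open>L x\<close>, and \<open>L x\<close> has as many colours as \<open>x\<close> has
  out-neighbours.\<close>

lemma card_avail:
  assumes "connected_set E Y" "Y \<subseteq> X" "dicolouring_on E L (V - Y) \<phi>" "x \<in> Y"
  shows "card (avail E L \<phi> Y x) = card (E `` {x} \<inter> Y)" "finite (avail E L \<phi> Y x)"
proof -
  note o = outside_colours[OF assms]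
  have "card (avail E L \<phi> Y x) = card (L x) - card (\<phi> ` (E `` {x} - Y))"
    unfolding avail_def using o finite_nbrs by (intro card_Diff_subset) auto
  also have "\<dots> = card (E `` {x}) - card (E `` {x} - Y)" using o by (simp add: card_image)
  also have "\<dots> = card (E `` {x} - (E `` {x} - Y))"
    using finite_nbrs by (intro card_Diff_subset[symmetric]) auto
  also have "E `` {x} - (E `` {x} - Y) = E `` {x} \<inter> Y" by blast
  finally show "card (avail E L \<phi> Y x) = card (E `` {x} \<inter> Y)" .
  show "finite (avail E L \<phi> Y x)" using o by (simp add: avail_def)
qed

lemma colour_vertex:
  assumes "Y \<subseteq> X" "dicolouring_on E L (V - Y) \<phi>" "v \<in> Y"
    and "a \<in> avail E L \<phi> Y v \<or> a \<in> avail (E\<inverse>) L \<phi> Y v"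
  shows "dicolouring_on E L (V - (Y - {v})) (\<phi>(v := a))"
proof -
  have "V - (Y - {v}) = insert v (V - Y)" using assms X_in_V by blast
  moreover have "dicolouring_on E L (insert v (V - Y)) (\<phi>(v := a))"
    using assms(4)
  proof
    assume "a \<in> avail E L \<phi> Y v"
    then show ?thesis
      by (intro dicolouring_on_insert_out assms loopless) (use assms in \<open>auto simp: avail_def\<close>)
  next
    assume "a \<in> avail (E\<inverse>) L \<phi> Y v"
    then show ?thesis
      by (intro dicolouring_on_insert_in assms loopless) (use assms in \<open>auto simp: avail_def\<close>)
  qed
  ultimately show ?thesis by simp
qed

text \<open>Colouring a non-cut vertex \<open>v\<close> of \<open>Y\<close> leaves a configuration of the same kind on
  \<open>Y - {v}\<close>, so the colour of \<open>v\<close> must have been available at \<open>u\<close>.\<close>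

lemma avail_transfer:
  assumes "nonseparable_set E Y" "Y \<subseteq> X" "dicolouring_on E L (V - Y) \<phi>"
    and "(u, v) \<in> E" "u \<in> Y" "v \<in> Y"
  shows "avail E L \<phi> Y v \<union> avail (E\<inverse>) L \<phi> Y v \<subseteq> avail E L \<phi> Y u"
proof
  fix a assume "a \<in> avail E L \<phi> Y v \<union> avail (E\<inverse>) L \<phi> Y v"
  then have d: "dicolouring_on E L (V - (Y - {v})) (\<phi>(v := a))"
    using colour_vertex assms by blast
  have uv: "u \<noteq> v" using assms loopless by blast
  then have "connected_set E (Y - {v})"
    using nonseparable_set_delete[OF assms(1,6)] assms(5) by blast
  moreover have "Y - {v} \<subseteq> X" "u \<in> Y - {v}" using assms uv by blast+
  ultimately
  \<comment> \<open>With respect to \<open>Y - {v}\<close>, the newly coloured \<open>v\<close> is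
    an outer out-neighbour of \<open>u\<close>: its colour \<open>a\<close> is in \<open>L u\<close>
    and differs from the colours of the others.\<close>
  have o: "inj_on (\<phi>(v := a)) (E `` {u} - (Y - {v}))"
    "(\<phi>(v := a)) ` (E `` {u} - (Y - {v})) \<subseteq> L u"
    using outside_colours[OF _ _ d] by blast+
  have v: "v \<in> E `` {u} - (Y - {v})" using assms uv by blast
  then have "a \<in> L u" using o(2) by force
  moreover have "a \<notin> \<phi> ` (E `` {u} - Y)"
  proof
    assume "a \<in> \<phi> ` (E `` {u} - Y)"
    then obtain w where "w \<in> E `` {u} - Y" "\<phi> w = a" by blast
    then show False using inj_onD[OF o(1), of w v] v assms by auto
  qed
  ultimately show "a \<in> avail E L \<phi> Y u" by (simp add: avail_def)
qed

text \<open>Let \<open>T x\<close> collect the colours available at \<open>x\<close> on either side.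
  For an arc \<open>(u, v)\<close>, \<open>avail_transfer\<close> and its converse give
  \<open>T v \<subseteq> avail E L \<phi> Y u \<subseteq> T u\<close> and \<open>T u \<subseteq>
  avail (E\<inverse>) L \<phi> Y v \<subseteq> T v\<close>, so all are equal. Connectedness makes
  \<open>T\<close> constant.\<close>

lemma avail_constant:
  assumes "nonseparable_set E Y" "Y \<subseteq> X" "dicolouring_on E L (V - Y) \<phi>" "Y \<noteq> {x0}" "x0 \<in> Y"
  obtains S where "S \<noteq> {}" "finite S"
    "\<And>x. x \<in> Y \<Longrightarrow> E `` {x} \<inter> Y \<noteq> {} \<Longrightarrow> avail E L \<phi> Y x = S"
    "\<And>x. x \<in> Y \<Longrightarrow> E\<inverse> `` {x} \<inter> Y \<noteq> {} \<Longrightarrow> avail (E\<inverse>) L \<phi> Y x = S"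
proof -
  interpret conv: uncolourable "E\<inverse>" V L X by (rule converse)
  define T where "T x = avail E L \<phi> Y x \<union> avail (E\<inverse>) L \<phi> Y x" for x
  have con: "connected_set E Y" using assms nonseparable_set_connected by blast
  have arc: "avail E L \<phi> Y u = T u" "avail (E\<inverse>) L \<phi> Y v = T v" "T u = T v"
    if "(u, v) \<in> E" "u \<in> Y" "v \<in> Y" for u v
    using avail_transfer[OF assms(1-3) that] conv.avail_transfer[of Y \<phi> v u] that assms
    unfolding T_def by auto
  have T: "T x = T x0" if "x \<in> Y" for x
    using connected_set_induct[where P = "\<lambda>x. T x = T x0", OF con refl assms(5) _ that] arc(3)
    by metis
  obtain y where "y \<in> Y" "y \<noteq> x0" "adj E x0 y"
    using connected_set_neighbour[OF con assms(5,4)] .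
  then obtain u v where uv: "(u, v) \<in> E" "u \<in> Y" "v \<in> Y" using assms by blast
  have "card (avail E L \<phi> Y u) \<noteq> 0" "finite (avail E L \<phi> Y u)"
    using card_avail[OF con assms(2,3) uv(2)] uv finite_nbrs by auto
  then have "T x0 \<noteq> {}" "finite (T x0)" using arc(1)[OF uv] T uv by auto
  moreover have "avail E L \<phi> Y x = T x0" if "x \<in> Y" "E `` {x} \<inter> Y \<noteq> {}" for x
    using that arc(1) T by blast
  moreover have "avail (E\<inverse>) L \<phi> Y x = T x0" if "x \<in> Y" "E\<inverse> `` {x} \<inter> Y \<noteq> {}" for x
    using that arc(2) T by blast
  ultimately show ?thesis by (rule that)
qed

text \<open>The vertices of \<open>Y\<close> can be coloured by \<open>c\<close> in any order: no
  arc inside \<open>Y\<close> is monochromatic, so availability on one side keeps each new vertex a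
  sink or a source of its colour class.\<close>

lemma two_colour_extension:
  assumes "Y \<subseteq> X" "dicolouring_on E L (V - Y) \<phi>"
    and "\<And>x y. x \<in> Y \<Longrightarrow> y \<in> Y \<Longrightarrow> (x, y) \<in> E \<Longrightarrow> c x \<noteq> c y"
    and "\<And>x. x \<in> Y \<Longrightarrow> c x \<in> avail E L \<phi> Y x \<or> c x \<in> avail (E\<inverse>) L \<phi> Y x"
  shows False
proof -
  let ?\<psi> = "\<lambda>W x. if x \<in> W then c x else \<phi> x"
  have "finite Y" using assms X_in_V finite_V by (meson finite_subset)
  moreover have "W \<subseteq> Y \<Longrightarrow> dicolouring_on E L (V - Y \<union> W) (?\<psi> W)" if "finite W" for W
    using that
  proof induction
    case empty
    then show ?case using assms by simp
  next
    case (insert x W)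
    have d: "dicolouring_on E L (V - Y \<union> W) (?\<psi> W)" and x: "x \<in> Y" "x \<notin> V - Y \<union> W"
      using insert by auto
    have d': "dicolouring_on E L (insert x (V - Y \<union> W)) ((?\<psi> W)(x := c x))"
      using assms(4)[OF x(1)]
    proof
      assume cx: "c x \<in> avail E L \<phi> Y x"
      then show ?thesis
      proof (intro dicolouring_on_insert_out[OF d x(2) loopless])
        show "c x \<in> L x" using cx by (simp add: avail_def)
        fix y assume y: "y \<in> V - Y \<union> W" "(x, y) \<in> E"
        show "?\<psi> W y \<noteq> c x"
        proof (cases "y \<in> W")
          case True
          then show ?thesis using assms(3) x(1) y insert.prems by (metis insert_subset subsetD)
        next
          case False
          then have "y \<notin> Y" using y by blast
          then show ?thesis using False y cx by (force simp: avail_def)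
        qed
      qed
    next
      assume cx: "c x \<in> avail (E\<inverse>) L \<phi> Y x"
      then show ?thesis
      proof (intro dicolouring_on_insert_in[OF d x(2) loopless])
        show "c x \<in> L x" using cx by (simp add: avail_def)
        fix y assume y: "y \<in> V - Y \<union> W" "(y, x) \<in> E"
        show "?\<psi> W y \<noteq> c x"
        proof (cases "y \<in> W")
          case True
          then show ?thesis using assms(3) x(1) y insert.prems by (metis insert_subset subsetD)
        next
          case False
          then have "y \<notin> Y" using y by blast
          then show ?thesis using False y cx by (force simp: avail_def)
        qed
      qed
    qed
    have "(?\<psi> W)(x := c x) = ?\<psi> (insert x W)" by auto
    moreover have "insert x (V - Y \<union> W) = V - Y \<union> insert x W" by blast
    ultimately show ?case using d' by (simp only:)
  qed
  ultimately have "dicolouring_on E L (V - Y \<union> Y) (?\<psi> Y)" by blast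
  moreover have "V - Y \<union> Y = V" using assms X_in_V by blast
  ultimately show False using no_dicolouring by simp
qed

text \<open>\<open>r\<close> is the size of the common set \<open>S\<close> of available colours. A
  labelling \<open>f\<close> without monochromatic arcs would allow a colouring of \<open>Y\<close>
  with two colours of \<open>S\<close>.\<close>

lemma degrees_in_nonseparable:
  assumes "nonseparable_set E Y" "Y \<subseteq> X" "dicolouring_on E L (V - Y) \<phi>" "Y \<noteq> {x0}" "x0 \<in> Y"
  obtains r where "0 < r"
    "\<And>x. x \<in> Y \<Longrightarrow> card (E `` {x} \<inter> Y) \<in> {0, r} \<and> card (E\<inverse> `` {x} \<inter> Y) \<in> {0, r}"
    "\<And>f :: 'a \<Rightarrow> bool. 2 \<le> r \<Longrightarrow> \<exists>x \<in> Y. \<exists>y \<in> Y. (x, y) \<in> E \<and> f x = f y"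
proof -
  interpret conv: uncolourable "E\<inverse>" V L X by (rule converse)
  have con: "connected_set E Y" using assms nonseparable_set_connected by blast
  obtain S where S: "S \<noteq> {}" "finite S"
    "\<And>x. x \<in> Y \<Longrightarrow> E `` {x} \<inter> Y \<noteq> {} \<Longrightarrow> avail E L \<phi> Y x = S"
    "\<And>x. x \<in> Y \<Longrightarrow> E\<inverse> `` {x} \<inter> Y \<noteq> {} \<Longrightarrow> avail (E\<inverse>) L \<phi> Y x = S"
    using avail_constant[OF assms] by metis
  have "card (E `` {x} \<inter> Y) \<in> {0, card S} \<and> card (E\<inverse> `` {x} \<inter> Y) \<in> {0, card S}"
    if "x \<in> Y" for x
  proof
    show "card (E `` {x} \<inter> Y) \<in> {0, card S}"
      using card_avail(1)[OF con assms(2,3) that] S(3)[OF that]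
      by (cases "E `` {x} \<inter> Y = {}") auto
    have "card (avail (E\<inverse>) L \<phi> Y x) = card (E\<inverse> `` {x} \<inter> Y)"
      by (rule conv.card_avail(1)) (use con assms that in auto)
    then show "card (E\<inverse> `` {x} \<inter> Y) \<in> {0, card S}"
      using S(4)[OF that] by (cases "E\<inverse> `` {x} \<inter> Y = {}") auto
  qed
  moreover have "\<exists>x \<in> Y. \<exists>y \<in> Y. (x, y) \<in> E \<and> f x = f y" if "2 \<le> card S" for f :: "'a \<Rightarrow> bool"
  proof (rule ccontr)
    assume no: "\<not> ?thesis"
    obtain a b where ab: "a \<in> S" "b \<in> S" "a \<noteq> b"
      using \<open>2 \<le> card S\<close> by (metis card_le_Suc0_iff_eq S(2) not_less_eq_eq numeral_2_eq_2)
    have in_S: "avail E L \<phi> Y x = S \<or> avail (E\<inverse>) L \<phi> Y x = S" if x: "x \<in> Y" for x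
    proof -
      have "Y \<noteq> {x}" using assms x by auto
      then obtain y where "y \<in> Y" "adj E x y" using connected_set_neighbour[OF con x] by metis
      then have "E `` {x} \<inter> Y \<noteq> {} \<or> E\<inverse> `` {x} \<inter> Y \<noteq> {}" by auto
      then show ?thesis using S x by blast
    qed
    show False
      by (rule two_colour_extension[OF assms(2,3), of "\<lambda>x. if f x then a else b"])
        (use no ab in_S in \<open>auto split: if_splits\<close>)
  qed
  moreover have "0 < card S" using S by (simp add: card_gt_0_iff)
  ultimately show ?thesis using that[of "card S"] by simp
qed

end

section \<open>Cyclic enumerations\<close>

text \<open>Out-degree one yields a successor map \<open>s\<close>, in-degree one makes it a
  permutation of \<open>Y\<close>, and connectedness makes a single orbit exhaust
  \<open>Y\<close>.\<close>

lemma directed_cycle_enumeration: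
  assumes "finite Y" "connected_set E Y"
    and "\<And>x. x \<in> Y \<Longrightarrow> card (E `` {x} \<inter> Y) = 1" "\<And>x. x \<in> Y \<Longrightarrow> card (E\<inverse> `` {x} \<inter> Y) = 1"
  obtains vs where "distinct vs" "vs \<noteq> []" "set vs = Y"
    "E \<inter> Y \<times> Y = (\<Union>i < length vs. {(vs ! i, vs ! (Suc i mod length vs))})"
proof -
  have "\<exists>y. E `` {x} \<inter> Y = {y}" if "x \<in> Y" for x
    using assms(3)[OF that] by (simp add: card_1_singleton_iff)
  then obtain t where t: "\<And>x. x \<in> Y \<Longrightarrow> E `` {x} \<inter> Y = {t x}" by metis
  \<comment> \<open>The identity outside \<open>Y\<close> is what \<open>permutes\<close>
    demands.\<close>
  define s where "s x = (if x \<in> Y then t x else x)" for x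
  have s: "s x \<in> Y" "(x, s x) \<in> E" "\<And>y. y \<in> Y \<Longrightarrow> (x, y) \<in> E \<Longrightarrow> y = s x" if "x \<in> Y" for x
    using t[OF that] that by (auto simp: s_def)
  have "x = y" if xy: "x \<in> Y" "y \<in> Y" "s x = s y" for x y
  proof -
    obtain z where "E\<inverse> `` {s x} \<inter> Y = {z}"
      using assms(4)[OF s(1)[OF xy(1)]] by (auto simp: card_1_singleton_iff)
    moreover have "x \<in> E\<inverse> `` {s x} \<inter> Y" "y \<in> E\<inverse> `` {s x} \<inter> Y"
      using s(2)[OF xy(1)] s(2)[OF xy(2)] xy by auto
    ultimately show "x = y" by (metis singletonD)
  qed
  then have "inj_on s Y" by (rule inj_onI)
  moreover have "s ` Y = Y"
    using endo_inj_surj[OF assms(1) _ \<open>inj_on s Y\<close>] s(1) by blast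
  ultimately have "bij_betw s Y Y" by (simp add: bij_betw_def)
  then have "s permutes Y" by (rule bij_imp_permutes) (simp add: s_def)
  then have perm: "permutation s" using assms(1) permutation_permutes by blast
  obtain x0 where x0: "x0 \<in> Y" using assms(2) connected_set_nonempty by blast
  have orb: "x0 \<in> orbit s x0" using perm by (rule permutation_self_in_orbit)
  \<comment> \<open>The least positive number of steps after which \<open>s\<close> returns to
    \<open>x0\<close>.\<close>
  define n where "n = funpow_dist1 s x0 x0"
  define vs where "vs = map (\<lambda>i. (s ^^ i) x0) [0..<n]"
  have n: "0 < n" "length vs = n" by (simp_all add: n_def vs_def del: upt_Suc)
  have nth: "vs ! i = (s ^^ i) x0" if "i < n" for i using that by (simp add: vs_def)
  have in_Y: "(s ^^ i) x0 \<in> Y" for i by (induction i) (use x0 s(1) in auto)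
  have ret: "(s ^^ n) x0 = x0" unfolding n_def by (rule funpow_dist1_prop[OF orb])
  have succ: "vs ! (Suc i mod n) = s (vs ! i)" if "i < n" for i
  proof (cases "Suc i = n")
    case True
    have "s (vs ! i) = (s ^^ Suc i) x0" using nth[OF that] by simp
    then show ?thesis using True ret nth[of 0] n by simp
  next
    case False
    then show ?thesis using that nth by simp
  qed
  have dist: "distinct vs"
    unfolding vs_def n_def distinct_map using inj_on_funpow_dist1[OF orb]
    by (simp only: set_upt distinct_upt)
  have set: "set vs = (\<lambda>i. (s ^^ i) x0) ` {0..<n}" by (simp add: vs_def)
  then have sub: "set vs \<subseteq> Y" using in_Y by auto
  have closed: "s x \<in> set vs" if x: "x \<in> set vs" for x
  proof -
    obtain i where "i < n" "x = vs ! i" using x n by (metis in_set_conv_nth)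
    then show ?thesis using succ[of i] n by (metis mod_less_divisor nth_mem)
  qed
  \<comment> \<open>Surjectivity closes the orbit under predecessors, as adjacency may run against
    the arcs.\<close>
  have surj: "s ` set vs = set vs"
    using closed \<open>inj_on s Y\<close> sub
    by (intro endo_inj_surj) (auto intro: inj_on_subset)
  have "y \<in> set vs" if "y \<in> Y" for y
    using assms(2) _ x0
  proof (rule connected_set_induct[where P = "\<lambda>x. x \<in> set vs"])
    show "x0 \<in> set vs" using n(1) unfolding set by (intro image_eqI[of _ _ 0]) auto
    show "y \<in> Y" by (rule that)
    fix x y assume xy: "x \<in> Y" "y \<in> Y" "x \<in> set vs" "adj E x y"
    show "y \<in> set vs"
    proof (cases "(x, y) \<in> E")
      case True
      then show ?thesis using s(3) xy closed by metis
    next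
      case False
      obtain z where "z \<in> set vs" "x = s z" using xy(3) surj by (metis imageE)
      moreover have "x = s y" using False xy s(3) by blast
      ultimately show ?thesis using \<open>inj_on s Y\<close> sub xy(2) by (metis inj_onD subsetD)
    qed
  qed
  then have eq: "set vs = Y" using sub by blast
  have "E \<inter> Y \<times> Y = (\<lambda>x. (x, s x)) ` Y" using s by force
  also have "\<dots> = (\<lambda>x. (x, s x)) ` (!) vs ` {..<n}"
    unfolding eq[symmetric] using n by (metis lessThan_atLeast0 list.set_map map_nth set_upt)
  also have "\<dots> = (\<Union>i < n. {(vs ! i, vs ! (Suc i mod n))})" using succ by auto
  finally have arcs: "E \<inter> Y \<times> Y = (\<Union>i < n. {(vs ! i, vs ! (Suc i mod n))})" .
  show ?thesis by (rule that[OF dist _ eq arcs[folded n(2)]]) (use n in auto)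
qed

text \<open>The two ends of a longest path are adjacent: all neighbours of its last vertex lie on it, and
  an inner vertex of the path already has its two neighbours there.\<close>

lemma two_regular_enumeration:
  assumes "finite Y" "connected_set E Y" "\<And>x. (x, x) \<notin> E"
    and two: "\<And>x. x \<in> Y \<Longrightarrow> card {y \<in> Y. adj E x y} = 2"
  obtains vs where "distinct vs" "3 \<le> length vs" "set vs = Y"
    "{(x, y) \<in> Y \<times> Y. adj E x y} = (\<Union>i < length vs.
       {(vs ! i, vs ! (Suc i mod length vs)), (vs ! (Suc i mod length vs), vs ! i)})"
proof -
  let ?N = "\<lambda>x. {y \<in> Y. adj E x y}"
  define P where "P = (\<lambda>vs. vs \<noteq> [] \<and> distinct vs \<and> set vs \<subseteq> Y \<and>
    (\<forall>i. Suc i < length vs \<longrightarrow> adj E (vs ! i) (vs ! Suc i)))"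
  have finN: "finite (?N x)" for x using assms(1) by simp
  obtain x0 where "x0 \<in> Y" using assms(2) connected_set_nonempty by blast
  then have "P [x0]" by (simp add: P_def)
  moreover have "length vs < Suc (card Y)" if "P vs" for vs
  proof -
    have "length vs = card (set vs)" using that by (simp add: P_def distinct_card)
    then show ?thesis using that card_mono[OF assms(1)] by (simp add: P_def less_Suc_eq_le)
  qed
  ultimately obtain vs where vs: "P vs" and max: "\<And>ws. P ws \<Longrightarrow> length ws \<le> length vs"
    using ex_has_greatest_nat[of P "[x0]" length "Suc (card Y)"] by (metis less_imp_le)
  define n where "n = length vs"
  have n: "0 < n" "length vs = n" and dist: "distinct vs" and sub: "set vs \<subseteq> Y"
    and path: "\<And>i. Suc i < n \<Longrightarrow> adj E (vs ! i) (vs ! Suc i)"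
    using vs by (auto simp: P_def n_def)
  have nth_eq: "vs ! i = vs ! j \<longleftrightarrow> i = j" if "i < n" "j < n" for i j
    using nth_eq_iff_index_eq[OF dist] that n by simp
  have in_Y: "vs ! i \<in> Y" if "i < n" for i using that n sub nth_mem by blast
  let ?l = "vs ! (n - 1)"
  have lY: "?l \<in> Y" using in_Y n by simp
  have l_nbrs: "y \<in> set vs" if "y \<in> ?N ?l" for y
  proof (rule ccontr)
    assume y: "y \<notin> set vs"
    have "adj E ((vs @ [y]) ! i) ((vs @ [y]) ! Suc i)" if "Suc i < length (vs @ [y])" for i
    proof (cases "Suc i < n")
      case True
      then show ?thesis using path n by (simp add: nth_append)
    next
      case False
      then have "i = n - 1" using that n by simp
      then show ?thesis using \<open>y \<in> ?N ?l\<close> n by (simp add: nth_append)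
    qed
    then have "P (vs @ [y])" using \<open>y \<in> ?N ?l\<close> vs y unfolding P_def by simp
    then show False using max by fastforce
  qed
  obtain y z where yz: "?N ?l = {y, z}" "y \<noteq> z" using two[OF lY] by (auto simp: card_2_iff)
  then obtain a b where ab: "y = vs ! a" "z = vs ! b" "a < n" "b < n"
    using l_nbrs n by (metis in_set_conv_nth insertCI)
  have "vs ! a \<in> ?N ?l" "vs ! b \<in> ?N ?l" using yz ab by auto
  then have "a \<noteq> n - 1" "b \<noteq> n - 1" "a \<noteq> b" using assms(3) yz ab by auto
  \<comment> \<open>Of the two neighbours of the last vertex, the one that is not its predecessor on
    the path.\<close>
  define k where "k = (if a = n - 2 then b else a)"
  have k: "Suc k < n - 1" "adj E ?l (vs ! k)"
    using \<open>vs ! a \<in> ?N ?l\<close> \<open>vs ! b \<in> ?N ?l\<close> \<open>a \<noteq> n - 1\<close> \<open>b \<noteq> n - 1\<close> \<open>a \<noteq> b\<close> ab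
    by (auto simp: k_def)
  \<comment> \<open>An inner vertex \<open>vs ! k\<close> would have three neighbours: two along the
    path and the last vertex.\<close>
  have "k = 0"
  proof (rule ccontr)
    assume "k \<noteq> 0"
    have three: "{vs ! (k - 1), vs ! Suc k, ?l} \<subseteq> ?N (vs ! k)"
      using path[of "k - 1"] path[of k] k \<open>k \<noteq> 0\<close> in_Y by auto
    moreover have "card {vs ! (k - 1), vs ! Suc k, ?l} = 3"
    proof -
      have "k - 1 \<noteq> Suc k" "k - 1 \<noteq> n - 1" "Suc k \<noteq> n - 1" "k - 1 < n" "Suc k < n" "n - 1 < n"
        using k \<open>k \<noteq> 0\<close> by auto
      then show ?thesis using nth_eq by (simp add: card_insert_if)
    qed
    ultimately have "3 \<le> card (?N (vs ! k))" using card_mono[OF finN three] by simp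
    moreover have "card (?N (vs ! k)) = 2" using two in_Y k by simp
    ultimately show False by simp
  qed
  then have n3: "3 \<le> n" using k by simp
  have step: "adj E (vs ! i) (vs ! (Suc i mod n))" if "i < n" for i
  proof (cases "Suc i = n")
    case True
    then have "i = n - 1" by simp
    then show ?thesis using k(2) \<open>k = 0\<close> True by simp
  next
    case False
    then show ?thesis using path that by simp
  qed
  \<comment> \<open>The cyclic predecessor of \<open>i\<close>; it differs from the cyclic successor
    since \<open>n \<ge> 3\<close>.\<close>
  define q where "q i = (if i = 0 then n - 1 else i - 1)" for i
  have q: "q i < n" "Suc (q i) mod n = i" "q i \<noteq> Suc i mod n" if "i < n" for i
  proof -
    show "q i < n" "Suc (q i) mod n = i" using that by (auto simp: q_def)
    show "q i \<noteq> Suc i mod n"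
      using that n3 by (cases "Suc i = n") (auto simp: q_def)
  qed
  have nbrs: "?N (vs ! i) = {vs ! (Suc i mod n), vs ! q i}" if "i < n" for i
  proof (rule card_subset_eq[OF finN, symmetric])
    have "Suc i mod n < n" using n by simp
    then show "{vs ! (Suc i mod n), vs ! q i} \<subseteq> ?N (vs ! i)"
      using step[OF that] step[OF q(1)[OF that]] q(2)[OF that] in_Y q(1)[OF that] by auto
    show "card {vs ! (Suc i mod n), vs ! q i} = card (?N (vs ! i))"
      using q(1,3)[OF that] two[OF in_Y[OF that]] nth_eq[OF q(1)[OF that] \<open>Suc i mod n < n\<close>]
      by auto
  qed
  have "y \<in> set vs" if "y \<in> Y" for y
    using assms(2) _ lY
  proof (rule connected_set_induct[where P = "\<lambda>x. x \<in> set vs"])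
    show "?l \<in> set vs" using n by simp
    show "y \<in> Y" by (rule that)
    fix x y assume xy: "y \<in> Y" "x \<in> set vs" "adj E x y"
    obtain i where i: "i < n" "x = vs ! i" using xy(2) n by (metis in_set_conv_nth)
    have "y \<in> {vs ! (Suc i mod n), vs ! q i}" using nbrs[OF i(1)] xy i by blast
    moreover have "vs ! (Suc i mod n) \<in> set vs" "vs ! q i \<in> set vs"
      using n q(1)[OF i(1)] by auto
    ultimately show "y \<in> set vs" by blast
  qed
  then have eq: "set vs = Y" using sub by blast
  have adjs: "{(x, y) \<in> Y \<times> Y. adj E x y} = (\<Union>i < n.
       {(vs ! i, vs ! (Suc i mod n)), (vs ! (Suc i mod n), vs ! i)})" (is "?A = ?B")
  proof
    show "?A \<subseteq> ?B"
    proof (rule subrelI)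
      fix x y assume "(x, y) \<in> ?A"
      then have xy: "x \<in> Y" "y \<in> Y" "adj E x y" by simp_all
      then obtain i where i: "i < n" "x = vs ! i" using eq n by (metis in_set_conv_nth)
      have "y \<in> {vs ! (Suc i mod n), vs ! q i}" using nbrs[OF i(1)] xy i by blast
      then show "(x, y) \<in> ?B"
      proof
        assume "y = vs ! (Suc i mod n)"
        then show ?thesis using i by blast
      next
        assume "y \<in> {vs ! q i}"
        then have "(x, y) = (vs ! (Suc (q i) mod n), vs ! q i)" using i q by simp
        then show ?thesis using q(1)[OF i(1)] by blast
      qed
    qed
    show "?B \<subseteq> ?A"
    proof (rule subsetI)
      fix p assume "p \<in> ?B"
      then obtain i where i: "i < n"
        and p: "p \<in> {(vs ! i, vs ! (Suc i mod n)), (vs ! (Suc i mod n), vs ! i)}" by blast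
      have "vs ! i \<in> Y" "vs ! (Suc i mod n) \<in> Y" using in_Y i n by simp_all
      then show "p \<in> ?A" using step[OF i] p by auto
    qed
  qed
  show ?thesis by (rule that[OF dist _ eq adjs[folded n(2)]]) (use n3 n in simp)
qed

section \<open>Nonseparable sets with two-valued degrees\<close>

definition regular_on :: "('a \<times> 'a) set \<Rightarrow> nat \<Rightarrow> 'a set \<Rightarrow> bool" where
  "regular_on E p B \<longleftrightarrow>
     (\<forall>x \<in> B. card (E `` {x} \<inter> B) = p \<and> card (E\<inverse> `` {x} \<inter> B) = p)"

text \<open>The opposite arc is excluded: a pair of opposite arcs is regular and counts as
  complete.\<close>

definition single_arc_on :: "('a \<times> 'a) set \<Rightarrow> 'a set \<Rightarrow> bool" where
  "single_arc_on E B \<longleftrightarrow> (\<exists>x y. x \<noteq> y \<and> B = {x, y} \<and> (x, y) \<in> E \<and> (y, x) \<notin> E)"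

definition directed_cycle_on :: "('a \<times> 'a) set \<Rightarrow> 'a set \<Rightarrow> bool" where
  "directed_cycle_on E B \<longleftrightarrow> (\<exists>vs. distinct vs \<and> vs \<noteq> [] \<and> set vs = B \<and>
     E \<inter> B \<times> B = (\<Union>i < length vs. {(vs ! i, vs ! (Suc i mod length vs))}))"

definition symmetric_odd_cycle_on :: "('a \<times> 'a) set \<Rightarrow> 'a set \<Rightarrow> bool" where
  "symmetric_odd_cycle_on E B \<longleftrightarrow>
     (\<exists>vs. distinct vs \<and> odd (length vs) \<and> 3 \<le> length vs \<and> set vs = B \<and>
        E \<inter> B \<times> B = (\<Union>i < length vs.
          {(vs ! i, vs ! (Suc i mod length vs)), (vs ! (Suc i mod length vs), vs ! i)}))"

definition complete_on :: "('a \<times> 'a) set \<Rightarrow> 'a set \<Rightarrow> bool" where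
  "complete_on E B \<longleftrightarrow> (\<forall>x \<in> B. \<forall>y \<in> B. x \<noteq> y \<longrightarrow> (x, y) \<in> E)"

lemma complete_on_regular:
  assumes "complete_on E B" "\<And>x. (x, x) \<notin> E" "finite B"
  shows "regular_on E (card B - 1) B"
proof -
  have "E `` {x} \<inter> B = B - {x}" "E\<inverse> `` {x} \<inter> B = B - {x}" if "x \<in> B" for x
    using assms that by (auto simp: complete_on_def)
  then show ?thesis using assms by (simp add: regular_on_def)
qed

text \<open>What is kept of the colouring argument. \<open>not_bipartite\<close> expresses
  non-bipartiteness by Boolean labellings, and \<open>smaller\<close> carries the induction
  hypothesis for proper subsets of \<open>Y\<close>.\<close>

locale two_valued_degrees =
  fixes E :: "('a \<times> 'a) set" and Y :: "'a set" and r :: nat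
  assumes finite_Y: "finite Y" and loopless: "(x, x) \<notin> E"
    and nonsep: "nonseparable_set E Y" and card_Y: "3 \<le> card Y"
    and deg: "x \<in> Y \<Longrightarrow> card (E `` {x} \<inter> Y) \<in> {0, r} \<and> card (E\<inverse> `` {x} \<inter> Y) \<in> {0, r}"
    and not_bipartite: "2 \<le> r \<Longrightarrow> \<exists>x \<in> Y. \<exists>y \<in> Y. (x, y) \<in> E \<and> f x = (f y :: bool)"
    and smaller: "B \<subset> Y \<Longrightarrow> nonseparable_set E B \<Longrightarrow>
      single_arc_on E B \<or> (\<exists>p. regular_on E p B)"
begin

lemma con: "connected_set E Y" using nonsep by (rule nonseparable_set_connected)

lemma fin_out: "finite (E `` {x} \<inter> Y)" and fin_in: "finite (E\<inverse> `` {x} \<inter> Y)"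
  using finite_Y by auto

lemma out_deg: "(x, y) \<in> E \<Longrightarrow> x \<in> Y \<Longrightarrow> y \<in> Y \<Longrightarrow> card (E `` {x} \<inter> Y) = r"
  using deg[of x] fin_out[of x] by auto

lemma in_deg: "(y, x) \<in> E \<Longrightarrow> x \<in> Y \<Longrightarrow> y \<in> Y \<Longrightarrow> card (E\<inverse> `` {x} \<inter> Y) = r"
  using deg[of x] fin_in[of x] by auto

lemma not_singleton: "Y \<noteq> {x}" using card_Y by auto

lemma connected_delete: "v \<in> Y \<Longrightarrow> connected_set E (Y - {v})"
  using nonseparable_set_delete[OF nonsep] not_singleton by blast

text \<open>Inside \<open>B\<close> a vertex of \<open>K\<close> has both degrees
  \<open>p > 0\<close>, and \<open>v\<close> adds at most one to each. Both sums must be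
  \<open>r\<close>, so arcs to and from \<open>v\<close> occur together; they occur at
  \<open>x0\<close>, hence \<open>p + 1 = r\<close>, and then at every vertex of \<open>K\<close>.
  The bound on \<open>card B\<close> holds as there are no loops.\<close>

lemma attached_regular:
  assumes "v \<in> Y" "B \<subseteq> Y - {v}" "K \<subseteq> B" "x0 \<in> K" "adj E x0 v"
    and "\<forall>x \<in> K. \<forall>y \<in> Y - {v}. adj E x y \<longrightarrow> y \<in> B"
    and "connected_set E B" "B \<noteq> {x0}" "regular_on E p B"
  shows "p + 1 = r" "\<forall>x \<in> K. (x, v) \<in> E \<and> (v, x) \<in> E" "r \<le> card B"
proof -
  have finB: "finite B" using assms finite_Y by (meson finite_Diff finite_subset)
  have x0: "x0 \<in> B" using assms by blast
  have out: "card (E `` {x} \<inter> Y) = p + (if (x, v) \<in> E then 1 else 0)" if "x \<in> K" for x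
  proof -
    have "E `` {x} \<inter> Y = (if (x, v) \<in> E then insert v (E `` {x} \<inter> B) else E `` {x} \<inter> B)"
      using assms(1,2,6) that by auto
    moreover have "v \<notin> B" using assms by blast
    ultimately show ?thesis using assms(3,9) that finB by (auto simp: regular_on_def)
  qed
  have "in": "card (E\<inverse> `` {x} \<inter> Y) = p + (if (v, x) \<in> E then 1 else 0)" if "x \<in> K" for x
  proof -
    have "E\<inverse> `` {x} \<inter> Y = (if (v, x) \<in> E then insert v (E\<inverse> `` {x} \<inter> B) else E\<inverse> `` {x} \<inter> B)"
      using assms(1,2,6) that by auto
    moreover have "v \<notin> B" using assms by blast
    ultimately show ?thesis using assms(3,9) that finB by (auto simp: regular_on_def)
  qed
  obtain y where "y \<in> B" "adj E x0 y"
    using connected_set_neighbour[OF assms(7) x0 assms(8)] by metis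
  then have "E `` {x0} \<inter> B \<noteq> {} \<or> E\<inverse> `` {x0} \<inter> B \<noteq> {}" by auto
  then have "card (E `` {x0} \<inter> B) \<noteq> 0 \<or> card (E\<inverse> `` {x0} \<inter> B) \<noteq> 0" using finB by simp
  then have p: "0 < p" using assms(9) x0 by (auto simp: regular_on_def)
  have r: "p + (if (x, v) \<in> E then 1 else 0) = r" "p + (if (v, x) \<in> E then 1 else 0) = r"
    if "x \<in> K" for x
    using deg[of x] out[OF that] "in"[OF that] p assms(2,3) that by auto
  show pr: "p + 1 = r" using r[OF assms(4)] assms(5) by (auto split: if_splits)
  show "\<forall>x \<in> K. (x, v) \<in> E \<and> (v, x) \<in> E" 
  proof
    fix x assume "x \<in> K"
    from r[OF this] show "(x, v) \<in> E \<and> (v, x) \<in> E" using pr by (auto split: if_splits)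
  qed
  have "E `` {x0} \<inter> B \<subseteq> B - {x0}" using loopless by auto
  then have "card (E `` {x0} \<inter> B) \<le> card (B - {x0})" using finB by (simp add: card_mono)
  moreover have "card B = card (B - {x0}) + 1" using finB x0 by (metis card_Suc_Diff1 Suc_eq_plus1)
  moreover have "card (E `` {x0} \<inter> B) = p" using assms(9) x0 by (simp add: regular_on_def)
  ultimately show "r \<le> card B" using pr by linarith
qed

text \<open>Otherwise deleting \<open>d\<close> would cut \<open>K\<close> off from \<open>v\<close>
  in \<open>Y\<close>.\<close>

lemma end_block_attached:
  assumes "v \<in> Y" "end_block E (Y - {v}) K d"
  obtains x where "x \<in> K" "adj E x v"
proof -
  have d: "d \<in> Y" "d \<noteq> v" "d \<notin> K" and K: "K \<subseteq> Y - {v}" "K \<noteq> {}"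
    and nb: "\<And>x y. x \<in> K \<Longrightarrow> y \<in> Y - {v} \<Longrightarrow> adj E x y \<Longrightarrow> y \<in> insert d K"
    using assms by (auto simp: end_block_def)
  have "K \<subseteq> Y - {d}" "K \<noteq> Y - {d}" using d K assms by blast+
  then obtain x y where xy: "x \<in> K" "y \<in> Y - {d}" "y \<notin> K" "adj E x y"
    using connected_set_crossing[OF connected_delete[OF d(1)] _ K(2)] by metis
  then have "y = v" using nb[of x y] by blast
  then show ?thesis using that xy by blast
qed

text \<open>If the end block is a single arc, the only vertex of \<open>K\<close> has no neighbours
  but \<open>v\<close> and \<open>d\<close>, so \<open>r \<le> 2\<close>. If it is regular,
  \<open>attached_regular\<close> applies.\<close>

lemma end_block_cases:
  assumes "v \<in> Y" "2 \<le> r" "end_block E (Y - {v}) K d"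
  shows "r = 2 \<and> card K = 1 \<or> (\<forall>x \<in> K. (x, v) \<in> E \<and> (v, x) \<in> E) \<and> r \<le> card K + 1"
proof -
  let ?B = "insert d K"
  have d: "d \<in> Y" "d \<noteq> v" "d \<notin> K" and K: "K \<subseteq> Y - {v}" "K \<noteq> {}"
    and nb: "\<forall>x \<in> K. \<forall>y \<in> Y - {v}. adj E x y \<longrightarrow> y \<in> ?B"
    and ns: "nonseparable_set E ?B"
    using assms by (auto simp: end_block_def)
  have finK: "finite K" using K finite_Y by (meson finite_Diff finite_subset)
  obtain x0 where x0: "x0 \<in> K" "adj E x0 v" using end_block_attached[OF assms(1,3)] .
  have B: "?B \<subseteq> Y - {v}" "?B \<noteq> {x0}" using d K x0 by auto
  then have "?B \<subset> Y" using assms by blast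
  from smaller[OF this ns] show ?thesis
  proof
    assume "single_arc_on E ?B"
    then obtain a b where ab: "a \<noteq> b" "?B = {a, b}" "(a, b) \<in> E"
      by (auto simp: single_arc_on_def)
    then have "card ?B = 2" by simp
    then have "card K = 1" using d finK by simp
    then obtain x where x: "K = {x}" by (auto simp: card_1_singleton_iff)
    have "{x, d} = {a, b}" using ab x by auto
    then have adj: "adj E x d" using ab by (auto simp: doubleton_eq_iff)
    have xY: "x \<in> Y" using K x by blast
    have card_vd: "card {v, d} = 2" using d by simp
    have "r \<le> 2"
    proof (cases "(x, d) \<in> E")
      case True
      have "E `` {x} \<inter> Y \<subseteq> {v, d}" using nb x loopless by auto
      then have "card (E `` {x} \<inter> Y) \<le> 2" using card_mono card_vd by (metis finite.simps)
      then show ?thesis using out_deg[OF True xY d(1)] by simp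
    next
      case False
      have "E\<inverse> `` {x} \<inter> Y \<subseteq> {v, d}" using nb x loopless by auto
      then have "card (E\<inverse> `` {x} \<inter> Y) \<le> 2" using card_mono card_vd by (metis finite.simps)
      then show ?thesis using in_deg[of d x] False adj xY d(1) by simp
    qed
    then show ?thesis using \<open>card K = 1\<close> assms(2) by simp
  next
    assume "\<exists>p. regular_on E p ?B"
    then obtain p where "regular_on E p ?B" by blast
    note a = attached_regular[OF assms(1) B(1) _ x0 nb nonseparable_set_connected[OF ns] B(2) this]
    then show ?thesis using d finK by auto
  qed
qed

text \<open>Only end blocks with two vertices leave room at \<open>v\<close> for a second end block.\<close>

lemma delete_separable:
  assumes "v \<in> Y" "2 \<le> r" "\<not> nonseparable_set E (Y - {v})"
  obtains x1 x2 where "r = 2" "x1 \<noteq> x2" "x1 \<in> Y" "x2 \<in> Y" "adj E v x1" "adj E v x2"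
    "card {y \<in> Y. adj E x1 y} = 2" "card {y \<in> Y. adj E x2 y} = 2"
proof -
  obtain K1 d1 K2 d2 where ends: "K1 \<inter> K2 = {}"
    "end_block E (Y - {v}) K1 d1" "end_block E (Y - {v}) K2 d2"
    using two_end_blocks[OF _ connected_delete[OF assms(1)] assms(3)] finite_Y by (metis finite_Diff)
  have K: "K1 \<subseteq> Y" "K2 \<subseteq> Y" using ends by (auto simp: end_block_def)
  then have finK: "finite K1" "finite K2" using finite_Y finite_subset by blast+
  note c1 = end_block_cases[OF assms(1,2) ends(2)]
  note c2 = end_block_cases[OF assms(1,2) ends(3)]
  have le_out: "card A \<le> r" if "A \<subseteq> E `` {v} \<inter> Y" for A
    using card_mono[OF fin_out that] deg[OF assms(1)] by auto
  have le_in: "card A \<le> r" if "A \<subseteq> E\<inverse> `` {v} \<inter> Y" for A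
    using card_mono[OF fin_in that] deg[OF assms(1)] by auto
  \<comment> \<open>For \<open>r \<ge> 3\<close> both \<open>K1\<close> and \<open>K2\<close>
    consist of out-neighbours of \<open>v\<close> and have at least \<open>r - 1\<close> vertices,
    but \<open>2 * (r - 1) > r\<close>.\<close>
  have r2: "r = 2"
  proof (rule ccontr)
    assume "r \<noteq> 2"
    then have "K1 \<union> K2 \<subseteq> E `` {v} \<inter> Y" "r \<le> card K1 + 1" "r \<le> card K2 + 1"
      using c1 c2 K by auto
    moreover from this have "card (K1 \<union> K2) \<le> r" using le_out by blast
    ultimately show False
      using card_Un_disjoint[OF finK ends(1)] \<open>r \<noteq> 2\<close> assms(2) by simp
  qed
  \<comment> \<open>Otherwise \<open>K\<close> is joined to \<open>v\<close> in both directions, and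
    a neighbour of \<open>v\<close> in \<open>K'\<close> adds one more on some side, so
    \<open>card K + 1 \<le> r = 2\<close>.\<close>
  have one: "card K = 1"
    if ends': "K \<inter> K' = {}" "end_block E (Y - {v}) K d" "end_block E (Y - {v}) K' d'"
    for K K' d d'
  proof (cases "r = 2 \<and> card K = 1")
    case False
    then have K: "\<forall>x \<in> K. (x, v) \<in> E \<and> (v, x) \<in> E"
      using end_block_cases[OF assms(1,2) ends'(2)] by blast
    have sub: "K \<subseteq> Y" "K' \<subseteq> Y" "K \<noteq> {}" using ends' by (auto simp: end_block_def)
    have finK: "finite K" using sub finite_Y finite_subset by blast
    obtain x where x: "x \<in> K'" "adj E x v" using end_block_attached[OF assms(1) ends'(3)] .
    have "insert x K \<subseteq> E `` {v} \<inter> Y \<or> insert x K \<subseteq> E\<inverse> `` {v} \<inter> Y"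
      using K x sub by auto
    then have "card (insert x K) \<le> r" using le_out le_in by blast
    moreover have "x \<notin> K" using ends'(1) x by blast
    moreover have "0 < card K" using finK sub by (simp add: card_gt_0_iff)
    ultimately show ?thesis using r2 finK by (simp del: card_gt_0_iff)
  qed simp
  \<comment> \<open>Only \<open>v\<close> and \<open>d\<close> can be neighbours of the vertex of
    \<open>K\<close>; nonseparability of \<open>Y\<close> provides two.\<close>
  have leaf: "\<exists>x \<in> K. x \<in> Y \<and> adj E v x \<and> card {y \<in> Y. adj E x y} = 2"
    if K: "card K = 1" "end_block E (Y - {v}) K d" for K d
  proof -
    obtain x where x: "x \<in> K" "adj E x v" using end_block_attached[OF assms(1) K(2)] .
    then have Kx: "K = {x}" using K(1) by (auto simp: card_1_singleton_iff)
    have xY: "x \<in> Y" using K(2) x by (auto simp: end_block_def)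
    have "{y \<in> Y. adj E x y} \<subseteq> {v, d}"
      using K(2) Kx loopless by (auto simp: end_block_def)
    then have "card {y \<in> Y. adj E x y} \<le> card {v, d}" by (intro card_mono) auto
    also have "\<dots> \<le> 2" by (simp add: card_insert_if)
    finally have "card {y \<in> Y. adj E x y} \<le> 2" .
    moreover obtain y z where "y \<in> Y" "z \<in> Y" "y \<noteq> z" "adj E x y" "adj E x z"
      using nonseparable_set_two_neighbours[OF nonsep finite_Y card_Y xY] by metis
    then have "card {y, z} = 2" "{y, z} \<subseteq> {y \<in> Y. adj E x y}" by auto
    then have "2 \<le> card {y \<in> Y. adj E x y}"
      using card_mono[of "{y \<in> Y. adj E x y}" "{y, z}"] finite_Y by simp
    ultimately show ?thesis using x xY by auto
  qed
  obtain x1 where x1: "x1 \<in> K1" "x1 \<in> Y" "adj E v x1" "card {y \<in> Y. adj E x1 y} = 2"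
    using leaf[OF one[OF ends] ends(2)] by blast
  have "K2 \<inter> K1 = {}" using ends(1) by blast
  then obtain x2 where x2: "x2 \<in> K2" "x2 \<in> Y" "adj E v x2" "card {y \<in> Y. adj E x2 y} = 2"
    using leaf[OF one[OF _ ends(3,2)] ends(3)] by blast
  have "x1 \<noteq> x2" using x1(1) x2(1) ends(1) by blast
  then show ?thesis using that[OF r2 _ x1(2) x2(2) x1(3) x2(3) x1(4) x2(4)] by blast
qed

text \<open>In the regular case every vertex of \<open>Y - {v}\<close> is joined to \<open>v\<close>
  in both directions. So \<open>card (Y - {v}) = r = p + 1\<close>, and a \<open>p\<close>-regular
  set of this size is complete.\<close>

lemma delete_nonseparable:
  assumes "v \<in> Y" "2 \<le> r" "nonseparable_set E (Y - {v})"
  shows "complete_on E Y"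
proof -
  let ?B = "Y - {v}"
  obtain x0 where x0: "x0 \<in> ?B" "adj E x0 v"
    using connected_set_neighbour[OF con assms(1) not_singleton] by blast
  have cardB: "card Y = card ?B + 1" using assms(1) finite_Y
    by (metis card_Suc_Diff1 Suc_eq_plus1)
  have B: "?B \<subset> Y" using assms(1) by blast
  have Bx0: "?B \<noteq> {x0}"
  proof
    assume "?B = {x0}"
    then have "card ?B = card {x0}" by (rule arg_cong)
    also have "\<dots> = 1" by simp
    finally show False using cardB card_Y by linarith
  qed
  from smaller[OF B assms(3)] show ?thesis
  proof
    \<comment> \<open>Degrees below \<open>r\<close> must vanish here. This leaves \<open>v\<close>
      with \<open>y\<close> as its only out-neighbour, against \<open>r \<ge> 2\<close>.\<close>
    assume "single_arc_on E ?B"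
    then obtain x y where xy: "x \<noteq> y" "?B = {x, y}" "(x, y) \<in> E" "(y, x) \<notin> E"
      by (auto simp: single_arc_on_def)
    have Y: "Y = {x, y, v}" "x \<noteq> v" "y \<noteq> v" using xy assms(1) by blast+
    have out_y: "E `` {y} \<inter> Y \<subseteq> {v}" and in_x: "E\<inverse> `` {x} \<inter> Y \<subseteq> {v}"
      using Y xy loopless by auto
    have "card (E `` {y} \<inter> Y) \<le> 1" "card (E\<inverse> `` {x} \<inter> Y) \<le> 1"
      using card_mono[OF _ out_y] card_mono[OF _ in_x] by auto
    then have "card (E `` {y} \<inter> Y) = 0" "card (E\<inverse> `` {x} \<inter> Y) = 0"
      using deg[of x] deg[of y] assms(2) Y by auto
    then have no: "(y, v) \<notin> E" "(v, x) \<notin> E" using fin_out fin_in Y by auto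
    have "card (E\<inverse> `` {y} \<inter> Y) = r" using in_deg[OF xy(3)] Y by simp
    moreover have "E\<inverse> `` {y} \<inter> Y \<subseteq> {x}" if "(v, y) \<notin> E" using that Y loopless by auto
    then have "card (E\<inverse> `` {y} \<inter> Y) \<le> 1" if "(v, y) \<notin> E"
      using that card_mono[of "{x}" "E\<inverse> `` {y} \<inter> Y"] by auto
    ultimately have vy: "(v, y) \<in> E" using assms(2) by fastforce
    have "E `` {v} \<inter> Y \<subseteq> {y}" using Y no loopless by auto
    then have "card (E `` {v} \<inter> Y) \<le> 1" using card_mono[of "{y}"] by fastforce
    moreover have "card (E `` {v} \<inter> Y) = r" using out_deg[OF vy] Y by simp
    ultimately show ?thesis using assms(2) by simp
  next
    assume "\<exists>p. regular_on E p ?B"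
    then obtain p where p: "regular_on E p ?B" by blast
    have nb: "\<forall>x \<in> ?B. \<forall>y \<in> Y - {v}. adj E x y \<longrightarrow> y \<in> ?B" by blast
    note a = attached_regular[OF assms(1) subset_refl subset_refl x0 nb
        nonseparable_set_connected[OF assms(3)] Bx0 p]
    have "E `` {v} \<inter> Y = ?B" using a(2) loopless by auto
    then have "card ?B = r" using out_deg[of v x0] a(2) x0 assms(1) by auto
    then have card_p: "card ?B = p + 1" using a(1) by simp
    have "(x, y) \<in> E" if xy: "x \<in> ?B" "y \<in> ?B" "x \<noteq> y" for x y
    proof -
      have "E `` {x} \<inter> ?B = ?B - {x}"
      proof (rule card_subset_eq)
        show "E `` {x} \<inter> ?B \<subseteq> ?B - {x}" using loopless by auto
        show "card (E `` {x} \<inter> ?B) = card (?B - {x})"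
          using p xy card_p finite_Y by (simp add: regular_on_def)
      qed (use finite_Y in simp)
      then show ?thesis using xy by blast
    qed
    then show ?thesis using a(2) unfolding complete_on_def by blast
  qed
qed

text \<open>By \<open>delete_separable\<close> each \<open>v\<close> has two neighbours with exactly
  two neighbours each. If \<open>v\<close> itself has only two, these are all of its neighbours, so
  the property spreads over \<open>Y\<close>.\<close>

lemma symmetric_cycle:
  assumes "2 \<le> r" "\<And>v. v \<in> Y \<Longrightarrow> \<not> nonseparable_set E (Y - {v})"
  shows "symmetric_odd_cycle_on E Y" "regular_on E 2 Y"
proof -
  let ?N = "\<lambda>x. {y \<in> Y. adj E x y}"
  have finN: "finite (?N x)" for x using finite_Y by simp
  obtain v0 where v0: "v0 \<in> Y" using con connected_set_nonempty by blast
  obtain x0 x' where r2: "r = 2" and x0: "x0 \<noteq> x'" "x0 \<in> Y" "x' \<in> Y" "adj E v0 x0" "adj E v0 x'"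
    "card (?N x0) = 2" "card (?N x') = 2"
    by (rule delete_separable[OF v0 assms(1) assms(2)[OF v0]])
  have two: "card (?N x) = 2" if "x \<in> Y" for x
    using con x0(6) x0(2) _ that
  proof (rule connected_set_induct[where P = "\<lambda>x. card (?N x) = 2"])
    fix v y assume v: "v \<in> Y" "y \<in> Y" "card (?N v) = 2" "adj E v y"
    obtain x1 x2 where "r = 2" and x: "x1 \<noteq> x2" "x1 \<in> Y" "x2 \<in> Y" "adj E v x1" "adj E v x2"
      "card (?N x1) = 2" "card (?N x2) = 2"
      by (rule delete_separable[OF v(1) assms(1) assms(2)[OF v(1)]])
    have sub: "{x1, x2} \<subseteq> ?N v" and eq: "card {x1, x2} = card (?N v)" using x v(3) by auto
    have "y \<in> {x1, x2}" unfolding card_subset_eq[OF finN sub eq] using v by simp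
    then show "card (?N y) = 2" using x by blast
  qed
  \<comment> \<open>With only two neighbours in total, a balanced vertex is joined to each of them
    in both directions, so being balanced spreads as well.\<close>
  define bal where "bal x \<longleftrightarrow> card (E `` {x} \<inter> Y) = 2 \<and> card (E\<inverse> `` {x} \<inter> Y) = 2" for x
  have bal: "E `` {x} \<inter> Y = ?N x" "E\<inverse> `` {x} \<inter> Y = ?N x" if "bal x" "x \<in> Y" for x
  proof -
    have "E `` {x} \<inter> Y \<subseteq> ?N x" "E\<inverse> `` {x} \<inter> Y \<subseteq> ?N x" by auto
    then show "E `` {x} \<inter> Y = ?N x" "E\<inverse> `` {x} \<inter> Y = ?N x"
      using card_subset_eq[OF finN] two that by (simp_all add: bal_def)
  qed
  \<comment> \<open>Label vertices by whether their out-degree is \<open>0\<close>. On an arc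
    \<open>(x, y)\<close> with equal labels, \<open>y\<close> has an out-neighbour because
    \<open>x\<close> has one, and it has the in-neighbour \<open>x\<close>: it is balanced.\<close>
  have "\<exists>x \<in> Y. bal x"
  proof (rule ccontr)
    assume no: "\<not> ?thesis"
    obtain x y where xy: "x \<in> Y" "y \<in> Y" "(x, y) \<in> E"
      "(card (E `` {x} \<inter> Y) = 0) = (card (E `` {y} \<inter> Y) = 0)"
      using not_bipartite[OF assms(1), of "\<lambda>x. card (E `` {x} \<inter> Y) = 0"] by auto
    have "card (E `` {x} \<inter> Y) = 2" "card (E\<inverse> `` {y} \<inter> Y) = 2"
      using out_deg in_deg xy r2 by blast+
    then have "bal y" using xy deg[of y] r2 unfolding bal_def by auto
    then show False using no xy by blast
  qed
  then obtain b where b: "b \<in> Y" "bal b" by blast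
  have all_bal: "bal x" if "x \<in> Y" for x
    using con b(2) b(1) _ that
  proof (rule connected_set_induct[where P = bal])
    fix x y assume xy: "x \<in> Y" "y \<in> Y" "bal x" "adj E x y"
    then have "y \<in> E `` {x} \<inter> Y" "y \<in> E\<inverse> `` {x} \<inter> Y" using bal[OF xy(3,1)] by blast+
    then have "(x, y) \<in> E" "(y, x) \<in> E" by auto
    then show "bal y" using out_deg[of y x] in_deg[of x y] xy r2 by (simp add: bal_def)
  qed
  show "regular_on E 2 Y" using all_bal by (auto simp: regular_on_def bal_def)
  have sym: "adj E x y \<longleftrightarrow> (x, y) \<in> E" if "x \<in> Y" "y \<in> Y" for x y
    using bal(1)[OF all_bal[OF that(1)] that(1)] that by blast
  obtain vs where vs: "distinct vs" "3 \<le> length vs" "set vs = Y"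
    "{(x, y) \<in> Y \<times> Y. adj E x y} = (\<Union>i < length vs.
       {(vs ! i, vs ! (Suc i mod length vs)), (vs ! (Suc i mod length vs), vs ! i)})"
    by (rule two_regular_enumeration[OF finite_Y con loopless two])
  have arcs: "E \<inter> Y \<times> Y = (\<Union>i < length vs.
       {(vs ! i, vs ! (Suc i mod length vs)), (vs ! (Suc i mod length vs), vs ! i)})"
    unfolding vs(4)[symmetric] using sym by auto
  have "odd (length vs)"
  proof (rule ccontr)
    assume "\<not> odd (length vs)"
    then have even: "even (length vs)" by simp
    \<comment> \<open>The parity of the position on the cycle, a bipartition when the length is
      even.\<close>
    define f where "f x = even (the_inv_into {..<length vs} ((!) vs) x)" for x
    have "inj_on ((!) vs) {..<length vs}" using vs(1) by (simp add: inj_on_nth)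
    then have f: "f (vs ! i) = even i" if "i < length vs" for i
      using that by (simp add: f_def the_inv_into_f_f)
    obtain x y where xy: "x \<in> Y" "y \<in> Y" "(x, y) \<in> E" "f x = f y"
      using not_bipartite[OF assms(1)] by blast
    then have "(x, y) \<in> E \<inter> Y \<times> Y" by blast
    then obtain i where i: "i < length vs"
      "{x, y} = {vs ! i, vs ! (Suc i mod length vs)}"
      unfolding arcs by blast
    then have "f (vs ! i) = f (vs ! (Suc i mod length vs))"
      using xy(4) by (auto simp: doubleton_eq_iff)
    moreover have "Suc i mod length vs < length vs" using vs(2) by (intro mod_less_divisor) linarith
    ultimately have "even i = even (Suc i mod length vs)" using f i(1) by simp
    moreover have "even (Suc i mod length vs) = even (Suc i)"
      using even by (simp add: dvd_mod_iff)
    ultimately show False by simp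
  qed
  then show "symmetric_odd_cycle_on E Y"
    unfolding symmetric_odd_cycle_on_def using vs arcs by blast
qed

text \<open>Of two distinct neighbours of \<open>x\<close>, not both can be out-neighbours and not
  both in-neighbours; hence neither degree is \<open>0\<close>.\<close>

lemma degree_one:
  assumes "r = 1"
  shows "directed_cycle_on E Y" "regular_on E 1 Y"
proof -
  have one: "card (E `` {x} \<inter> Y) = 1 \<and> card (E\<inverse> `` {x} \<inter> Y) = 1" if x: "x \<in> Y" for x
  proof -
    obtain y z where yz: "y \<in> Y" "z \<in> Y" "y \<noteq> z" "adj E x y" "adj E x z"
      using nonseparable_set_two_neighbours[OF nonsep finite_Y card_Y x] by metis
    have "\<not> {y, z} \<subseteq> E `` {x} \<inter> Y"
      using card_mono[OF fin_out, of "{y, z}" x] deg[OF x] yz(3) assms by auto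
    moreover have "\<not> {y, z} \<subseteq> E\<inverse> `` {x} \<inter> Y"
      using card_mono[OF fin_in, of "{y, z}" x] deg[OF x] yz(3) assms by auto
    ultimately have "E `` {x} \<inter> Y \<noteq> {}" "E\<inverse> `` {x} \<inter> Y \<noteq> {}" using yz by auto
    then show ?thesis using deg[OF x] fin_out fin_in assms by auto
  qed
  then show "regular_on E 1 Y" by (simp add: regular_on_def)
  obtain vs where "distinct vs" "vs \<noteq> []" "set vs = Y"
    "E \<inter> Y \<times> Y = (\<Union>i < length vs. {(vs ! i, vs ! (Suc i mod length vs))})"
    by (rule directed_cycle_enumeration[OF finite_Y con]) (use one in auto)
  then show "directed_cycle_on E Y" unfolding directed_cycle_on_def by blast
qed

end

section \<open>Classification of the nonseparable subsets of \<open>X\<close>\<close>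

definition gallai_block :: "('a \<times> 'a) set \<Rightarrow> 'a set \<Rightarrow> bool" where
  "gallai_block E B \<longleftrightarrow> single_arc_on E B \<or> directed_cycle_on E B \<or>
     symmetric_odd_cycle_on E B \<or> complete_on E B"

lemma small_nonseparable:
  assumes "connected_set E Y" "finite Y" "card Y < 3"
  shows "single_arc_on E Y \<or> complete_on E Y"
proof -
  have "card Y \<noteq> 0" using assms connected_set_nonempty by auto
  then consider "card Y = 1" | "card Y = 2" using assms(3) by linarith
  then show ?thesis
  proof cases
    case 1
    then show ?thesis by (auto simp: card_1_singleton_iff complete_on_def)
  next
    case 2
    then obtain x y where xy: "Y = {x, y}" "x \<noteq> y" by (auto simp: card_2_iff)
    then have "adj E x y" using connected_set_neighbour[OF assms(1), of x] by blast
    then consider "(x, y) \<in> E" "(y, x) \<in> E" | "(x, y) \<in> E" "(y, x) \<notin> E"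
      | "(y, x) \<in> E" "(x, y) \<notin> E" by blast
    then show ?thesis
    proof cases
      case 1
      then show ?thesis using xy by (auto simp: complete_on_def)
    next
      case 2
      then show ?thesis using xy unfolding single_arc_on_def by blast
    next
      case 3
      then show ?thesis using xy unfolding single_arc_on_def by (metis insert_commute)
    qed
  qed
qed

text \<open>Strong induction on \<open>card Y\<close>. The second conjunct is what
  \<open>smaller\<close> asks of proper nonseparable subsets; the given dicolouring outside
  \<open>X\<close> is first extended to one outside \<open>Y\<close>.\<close>

lemma (in uncolourable) nonseparable_gallai_block:
  assumes "connected_set E X" "dicolouring_on E L (V - X) \<phi>"
    and "nonseparable_set E Y" "Y \<subseteq> X"
  shows "gallai_block E Y \<and> (single_arc_on E Y \<or> (\<exists>p. regular_on E p Y))"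
  using assms(3,4)
proof (induction "card Y" arbitrary: Y rule: less_induct)
  case less
  have finY: "finite Y" using less.prems X_in_V finite_V by (meson finite_subset)
  have con: "connected_set E Y" using less.prems nonseparable_set_connected by blast
  then have "Y \<noteq> {}" by (rule connected_set_nonempty)
  then obtain \<psi> where \<psi>: "dicolouring_on E L (V - Y) \<psi>"
    using dicolouring_on_grow[OF assms(1) subset_refl assms(2) less.prems(2)] by metis
  show ?case
  proof (cases "card Y < 3")
    case True
    then show ?thesis
      using small_nonseparable[OF con finY] complete_on_regular[OF _ loopless finY]
      by (auto simp: gallai_block_def)
  next
    case False
    then have card3: "3 \<le> card Y" by simp
    obtain x0 where x0: "x0 \<in> Y" using \<open>Y \<noteq> {}\<close> by blast
    have "Y \<noteq> {x0}" using card3 by auto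
    from degrees_in_nonseparable[OF less.prems \<psi> this x0]
    obtain r where r: "0 < r"
      "\<And>x. x \<in> Y \<Longrightarrow> card (E `` {x} \<inter> Y) \<in> {0, r} \<and> card (E\<inverse> `` {x} \<inter> Y) \<in> {0, r}"
      "\<And>f :: 'a \<Rightarrow> bool. 2 \<le> r \<Longrightarrow> \<exists>x \<in> Y. \<exists>y \<in> Y. (x, y) \<in> E \<and> f x = f y"
      by metis
    interpret two_valued_degrees E Y r
    proof unfold_locales
      fix B assume "B \<subset> Y" "nonseparable_set E B"
      then show "single_arc_on E B \<or> (\<exists>p. regular_on E p B)"
        using less.hyps[of B] less.prems(2) psubset_card_mono[OF finY] by blast
    qed (use finY loopless less.prems card3 r in auto)
    consider "r = 1" | v where "2 \<le> r" "v \<in> Y" "nonseparable_set E (Y - {v})"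
      | "2 \<le> r" "\<And>v. v \<in> Y \<Longrightarrow> \<not> nonseparable_set E (Y - {v})"
      using r(1) by force
    then show ?thesis
    proof cases
      case 1
      then show ?thesis using degree_one by (auto simp: gallai_block_def)
    next
      case 2
      then have "complete_on E Y" using delete_nonseparable by blast
      then show ?thesis
        using complete_on_regular[OF _ loopless finY] by (auto simp: gallai_block_def)
    next
      case 3
      then show ?thesis using symmetric_cycle by (auto simp: gallai_block_def)
    qed
  qed
qed

section \<open>From digraphs to relations\<close>

lemma arcs_ends_induce: "arcs_ends (G \<restriction> S) = arcs_ends G \<inter> S \<times> S"
  by (auto simp: arcs_ends_conv)

lemma connected_set_restrict [simp]:
  "connected_set (E \<inter> Y \<times> Y) Y \<longleftrightarrow> connected_set E Y"
proof -
  have "(\<exists>x \<in> A. \<exists>y \<in> Y - A. adj (E \<inter> Y \<times> Y) x y) \<longleftrightarrow> (\<exists>x \<in> A. \<exists>y \<in> Y - A. adj E x y)"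
    if "A \<subset> Y" for A
    using that by blast
  then show ?thesis by (simp add: connected_set_def)
qed

lemma connected_set_mono:
  assumes "connected_set E Y" "E \<subseteq> F"
  shows "connected_set F Y"
proof (rule connected_setI)
  show "Y \<noteq> {}" using assms(1) by (rule connected_set_nonempty)
  fix A assume "A \<subset> Y" "A \<noteq> {}"
  then have "\<exists>x \<in> A. \<exists>y \<in> Y - A. adj E x y" using assms(1) by (simp add: connected_set_def)
  then show "\<exists>x \<in> A. \<exists>y \<in> Y - A. adj F x y" using assms(2) by blast
qed

lemma nonseparable_set_mono: "nonseparable_set E Y \<Longrightarrow> E \<subseteq> F \<Longrightarrow> nonseparable_set F Y"
  using connected_set_mono[of E _ F] by (auto simp: nonseparable_set_def)

lemma parcs_mk_symmetric_adj: "(x, y) \<in> parcs (mk_symmetric G) \<longleftrightarrow> adj (arcs_ends G) x y"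
  by (auto simp: parcs_mk_symmetric arcs_ends_conv)

text \<open>A walk in the symmetric closure from inside \<open>A\<close> to outside must cross the
  boundary of \<open>A\<close>; conversely reachability spreads by
  \<open>connected_set_induct\<close>.\<close>

lemma connected_iff_connected_set:
  "connected G \<longleftrightarrow> connected_set (arcs_ends G) (verts G)"
proof
  assume con: "connected G"
  show "connected_set (arcs_ends G) (verts G)"
  proof (rule connected_setI)
    show "verts G \<noteq> {}" using con by (simp add: connected_def strongly_connected_def)
    fix A assume A: "A \<subset> verts G" "A \<noteq> {}"
    then obtain u v where u: "u \<in> A" and v: "v \<in> verts G" "v \<notin> A" by blast
    have "(u, v) \<in> rtrancl_on (verts G) (parcs (mk_symmetric G))"
      using con A u v by (auto simp: connected_def strongly_connected_def reachable_def)
    then have "v \<in> A \<or> (\<exists>x \<in> A. \<exists>y \<in> verts G - A. adj (arcs_ends G) x y)"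
    proof (induction rule: rtrancl_on_induct)
      case base
      then show ?case using u by blast
    next
      case (step y z)
      then show ?case by (auto simp: parcs_mk_symmetric_adj)
    qed
    then show "\<exists>x \<in> A. \<exists>y \<in> verts G - A. adj (arcs_ends G) x y" using v by blast
  qed
next
  assume con: "connected_set (arcs_ends G) (verts G)"
  have "(u, v) \<in> rtrancl_on (verts G) (parcs (mk_symmetric G))"
    if "u \<in> verts G" "v \<in> verts G" for u v
    using con rtrancl_on_refl[OF that(1)] that(1) _ that(2)
  proof (rule connected_set_induct[where P = "\<lambda>v. (u, v) \<in> rtrancl_on (verts G) _"])
    fix x y assume "x \<in> verts G" "y \<in> verts G" "adj (arcs_ends G) x y"
      "(u, x) \<in> rtrancl_on (verts G) (parcs (mk_symmetric G))"
    then show "(u, y) \<in> rtrancl_on (verts G) (parcs (mk_symmetric G))"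
      by (auto intro: rtrancl_on_into_rtrancl_on simp: parcs_mk_symmetric_adj)
  qed
  then show "connected G"
    using connected_set_nonempty[OF con]
    by (simp add: connected_def strongly_connected_def reachable_def)
qed

lemma nonseparable_iff_nonseparable_set:
  "nonseparable G \<longleftrightarrow> nonseparable_set (arcs_ends G) (verts G)"
proof -
  have "connected (pre_digraph.del_vert G v) \<longleftrightarrow> connected_set (arcs_ends G) (verts G - {v})" for v
  proof -
    have "connected_set (arcs_ends (pre_digraph.del_vert G v)) (verts G - {v}) \<longleftrightarrow>
      connected_set (arcs_ends G) (verts G - {v})" (is "connected_set ?D ?W \<longleftrightarrow> _")
    proof -
      have "?D \<inter> ?W \<times> ?W = arcs_ends G \<inter> ?W \<times> ?W"
        by (auto simp: arcs_ends_conv pre_digraph.del_vert_simps)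
      then show ?thesis by (metis connected_set_restrict)
    qed
    then show ?thesis by (simp add: connected_iff_connected_set pre_digraph.verts_del_vert)
  qed
  then show ?thesis
    by (auto simp: nonseparable_def cut_vertex_def nonseparable_set_def
        connected_iff_connected_set)
qed

text \<open>Without parallel arcs, an arc leaving \<open>x\<close> is determined by its
  head.\<close>

lemma (in digraph) out_degree_eq_card: "out_degree G x = card (arcs_ends G `` {x})"
proof -
  have "bij_betw (head G) (out_arcs G x) (arcs_ends G `` {x})"
    unfolding bij_betw_def
  proof
    show "inj_on (head G) (out_arcs G x)"
      by (rule inj_onI) (auto simp: out_arcs_def arc_to_ends_def intro!: no_multi_arcs)
    show "head G ` out_arcs G x = arcs_ends G `` {x}"
      by (auto simp: out_arcs_def arcs_ends_conv)
  qed
  then show ?thesis unfolding out_degree_def by (rule bij_betw_same_card)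
qed

lemma (in digraph) in_degree_eq_card: "in_degree G x = card ((arcs_ends G)\<inverse> `` {x})"
proof -
  have "bij_betw (tail G) (in_arcs G x) ((arcs_ends G)\<inverse> `` {x})"
    unfolding bij_betw_def
  proof
    show "inj_on (tail G) (in_arcs G x)"
      by (rule inj_onI) (auto simp: in_arcs_def arc_to_ends_def intro!: no_multi_arcs)
    show "tail G ` in_arcs G x = (arcs_ends G)\<inverse> `` {x}"
      by (auto simp: in_arcs_def arcs_ends_conv)
  qed
  then show ?thesis unfolding in_degree_def by (rule bij_betw_same_card)
qed

text \<open>A cycle of the relation is a nontrivial closed walk, and every such walk contains a
  directed cycle.\<close>

lemma (in wf_digraph) acyclic_digraph_iff_acyclic:
  "acyclic_digraph G \<longleftrightarrow> acyclic (arcs_ends G)"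
proof
  assume a: "acyclic_digraph G"
  have "(x, x) \<notin> (arcs_ends G)\<^sup>+" for x
  proof
    assume "(x, x) \<in> (arcs_ends G)\<^sup>+"
    then obtain p where "awalk x p x" "p \<noteq> []" by (auto simp: reachable1_awalk)
    then have "closed_w p" by (auto simp: closed_w_def)
    then show False using a closed_w_imp_cycle by (auto simp: acyclic_digraph_def)
  qed
  then show "acyclic (arcs_ends G)" by (simp add: acyclic_def)
next
  assume a: "acyclic (arcs_ends G)"
  have "\<not> cycle p" for p
    using a reachable1_awalkI unfolding cycle_def acyclic_def by metis
  then show "acyclic_digraph G" by (simp add: acyclic_digraph_def)
qed

text \<open>The colour is constant along a walk of monochromatic arcs, so the walk stays in one
  class.\<close>

lemma acyclic_mono_arcs_iff:
  "acyclic (mono_arcs E \<phi> C) \<longleftrightarrow>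
     (\<forall>c. acyclic (E \<inter> {v \<in> C. \<phi> v = c} \<times> {v \<in> C. \<phi> v = c}))"
proof
  assume a: "acyclic (mono_arcs E \<phi> C)"
  show "\<forall>c. acyclic (E \<inter> {v \<in> C. \<phi> v = c} \<times> {v \<in> C. \<phi> v = c})"
    by (auto simp: mono_arcs_def intro!: acyclic_subset[OF a])
next
  let ?R = "\<lambda>c. E \<inter> {v \<in> C. \<phi> v = c} \<times> {v \<in> C. \<phi> v = c}"
  assume a: "\<forall>c. acyclic (?R c)"
  have "(x, y) \<in> (mono_arcs E \<phi> C)\<^sup>+ \<Longrightarrow> \<phi> x = \<phi> y \<and> (x, y) \<in> (?R (\<phi> x))\<^sup>+" for x y
  proof (induction rule: trancl_induct)
    case (base y)
    then show ?case by (auto simp: mono_arcs_def)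
  next
    case (step y z)
    then have "\<phi> x = \<phi> z" "(y, z) \<in> ?R (\<phi> x)" by (auto simp: mono_arcs_def)
    then show ?case using step.IH by (auto intro: trancl_into_trancl)
  qed
  then show "acyclic (mono_arcs E \<phi> C)" using a unfolding acyclic_def by blast
qed

lemma (in wf_digraph) list_dicolouring_induce:
  assumes "S \<subseteq> verts G"
  shows "list_dicolouring (G \<restriction> S) L \<phi> \<longleftrightarrow> dicolouring_on (arcs_ends G) L S \<phi>"
proof -
  have "acyclic_digraph ((G \<restriction> S) \<restriction> {v \<in> verts (G \<restriction> S). \<phi> v = c}) \<longleftrightarrow>
    acyclic (arcs_ends G \<inter> {v \<in> S. \<phi> v = c} \<times> {v \<in> S. \<phi> v = c})" for c
  proof -
    let ?T = "{v \<in> S. \<phi> v = c}"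
    have "wf_digraph ((G \<restriction> S) \<restriction> ?T)"
      using assms by (intro wf_digraph.wellformed_induce_subgraph wellformed_induce_subgraph)
    moreover have "arcs_ends ((G \<restriction> S) \<restriction> ?T) = arcs_ends G \<inter> ?T \<times> ?T"
      by (auto simp: arcs_ends_induce)
    ultimately show ?thesis using wf_digraph.acyclic_digraph_iff_acyclic by fastforce
  qed
  then show ?thesis
    by (simp add: list_dicolouring_def dicolouring_on_def acyclic_mono_arcs_iff)
qed

lemma (in wf_digraph) list_dicolouring_iff:
  "list_dicolouring G L \<phi> \<longleftrightarrow> dicolouring_on (arcs_ends G) L (verts G) \<phi>"
proof -
  have "G \<restriction> verts G = G" by (rule pre_digraph.equality) auto
  then show ?thesis using list_dicolouring_induce[OF subset_refl] by metis
qed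

section \<open>From block shapes of vertex sets back to digraphs\<close>

lemma (in digraph) single_arc_if:
  assumes "single_arc_on (arcs_ends G) (verts G)"
  shows "single_arc G"
proof -
  obtain x y where xy: "x \<noteq> y" "verts G = {x, y}" "(x, y) \<in> arcs_ends G" "(y, x) \<notin> arcs_ends G"
    using assms by (auto simp: single_arc_on_def)
  then obtain e where e: "e \<in> arcs G" "tail G e = x" "head G e = y" by auto
  have "e' = e" if e': "e' \<in> arcs G" for e'
  proof (rule no_multi_arcs[OF e' e(1)])
    have "tail G e' \<in> {x, y}" "head G e' \<in> {x, y}" using e' xy(2) wellformed by blast+
    moreover have "tail G e' \<noteq> head G e'" using no_loops[OF e'] .
    moreover have "(tail G e', head G e') \<in> arcs_ends G" using e' by (auto simp: arcs_ends_conv)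
    ultimately show "arc_to_ends G e' = arc_to_ends G e"
      using xy(4) e by (auto simp: arc_to_ends_def)
  qed
  then have "arcs G = {e}" using e(1) by blast
  then show ?thesis using xy(2) e digraph_axioms unfolding single_arc_def by blast
qed

lemma (in digraph) directed_cycle_if:
  assumes "directed_cycle_on (arcs_ends G) (verts G)"
  shows "directed_cycle G"
proof -
  obtain vs where vs: "distinct vs" "vs \<noteq> []" "set vs = verts G"
    "arcs_ends G \<inter> verts G \<times> verts G = (\<Union>i < length vs. {(vs ! i, vs ! (Suc i mod length vs))})"
    using assms unfolding directed_cycle_on_def by (elim exE conjE)
  define n where "n = length vs"
  \<comment> \<open>Periodic continuation of \<open>vs\<close>, so that the closing arc is no
    special case.\<close>
  define w where "w i = vs ! (i mod n)" for i
  have n: "0 < n" using vs(2) by (simp add: n_def)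
  have "arcs_ends G \<subseteq> verts G \<times> verts G" by (auto simp: arcs_ends_conv)
  then have ends: "arcs_ends G = (\<Union>i < n. {(vs ! i, vs ! (Suc i mod n))})"
    using vs(4) unfolding n_def by blast
  have "(w i, w (Suc i)) \<in> arcs_ends G" for i
  proof -
    have "(vs ! (i mod n), vs ! (Suc (i mod n) mod n)) \<in> arcs_ends G"
      unfolding ends using n by (intro UN_I[of "i mod n"]) auto
    then show ?thesis by (simp add: w_def mod_Suc_eq)
  qed
  then have "\<exists>e. e \<in> arcs G \<and> tail G e = w i \<and> head G e = w (Suc i)" for i
    by (rule reachableE) blast
  then obtain g where g: "\<And>i. g i \<in> arcs G" "\<And>i. tail G (g i) = w i" "\<And>i. head G (g i) = w (Suc i)"
    by metis
  define p where "p = map g [0..<n]"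
  have tails: "map (tail G) p = vs"
    by (rule nth_equalityI) (auto simp: p_def n_def[symmetric] g w_def)
  have heads: "map (head G) p = rotate1 vs"
    by (rule nth_equalityI) (auto simp: p_def n_def[symmetric] g w_def nth_rotate1)
  have cas: "cas (w i) (map g [i..<i + k]) (w (i + k))" for i k
  proof (induction k arbitrary: i)
    case (Suc k)
    have "[i..<i + Suc k] = i # [Suc i..<Suc i + k]" by (simp add: upt_conv_Cons)
    then show ?case using Suc[of "Suc i"] g by simp
  qed simp
  have "w n = w 0" by (simp add: w_def)
  then have closed: "cas (w 0) p (w 0)" using cas[of 0 n] by (simp add: p_def)
  have sub: "set p \<subseteq> arcs G" using g(1) by (auto simp: p_def)
  have "vs ! 0 \<in> set vs" using vs(2) by simp
  then have "w 0 \<in> verts G" unfolding vs(3) by (simp add: w_def)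
  then have "awalk (w 0) p (w 0)" using closed sub by (simp add: awalk_def)
  moreover have p: "p \<noteq> []" using n by (simp add: p_def)
  \<comment> \<open>Without its first vertex, the walk lists the heads of its arcs, a rotation of
    \<open>vs\<close>, so no vertex repeats.\<close>
  moreover have "tl (awalk_verts (w 0) p) = rotate1 vs"
    using awalk_verts_conv'[OF closed] heads p by simp
  ultimately have "cycle p" using vs(1) unfolding cycle_def by (metis distinct1_rotate)
  moreover have "arcs G = set p"
  proof
    show "arcs G \<subseteq> set p"
    proof
      fix e assume e: "e \<in> arcs G"
      then have "(tail G e, head G e) \<in> arcs_ends G" by (auto simp: arcs_ends_conv)
      then obtain i where i: "i < n" "tail G e = vs ! i" "head G e = vs ! (Suc i mod n)"
        unfolding ends by blast
      then have "e = g i"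
        by (intro no_multi_arcs[OF e g(1)]) (simp add: arc_to_ends_def g w_def)
      then show "e \<in> set p" using i(1) by (simp add: p_def)
    qed
  qed (rule sub)
  moreover have "verts G = tail G ` set p" using vs(3) tails by (metis set_map)
  ultimately show ?thesis using digraph_axioms unfolding directed_cycle_def by blast
qed

lemma (in digraph) gallai_block_digraph:
  assumes "gallai_block (arcs_ends G) (verts G)"
  shows "single_arc G \<or> directed_cycle G \<or> symmetric_odd_cycle G \<or> complete_symmetric G"
proof -
  have sub: "arcs_ends G \<inter> verts G \<times> verts G = arcs_ends G" by (auto simp: arcs_ends_conv)
  have "symmetric_odd_cycle G" if odd: "symmetric_odd_cycle_on (arcs_ends G) (verts G)"
  proof -
    obtain vs where "distinct vs" "odd (length vs)" "3 \<le> length vs" "set vs = verts G"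
      "arcs_ends G = (\<Union>i < length vs.
        {(vs ! i, vs ! (Suc i mod length vs)), (vs ! (Suc i mod length vs), vs ! i)})"
      using odd unfolding symmetric_odd_cycle_on_def sub by (elim exE conjE)
    then show ?thesis
      using digraph_axioms unfolding symmetric_odd_cycle_def by (intro conjI exI[of _ vs]) simp_all
  qed
  moreover have "complete_symmetric G" if c: "complete_on (arcs_ends G) (verts G)"
  proof -
    have ends: "arcs_ends G = {(u, v). (u, v) \<in> verts G \<times> verts G \<and> u \<noteq> v}"
      using c no_loops by (auto simp: complete_on_def arcs_ends_conv)
    then have "graph G" by (intro graphI) (auto simp: symmetric_def sym_def)
    then show ?thesis using ends by (auto simp: complete_symmetric_def complete_digraph_def)
  qed
  ultimately show ?thesis
    using assms single_arc_if directed_cycle_if unfolding gallai_block_def by blast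
qed

lemma gallai_block_restrict: "gallai_block E B \<Longrightarrow> gallai_block (E \<inter> B \<times> B) B"
proof -
  have "single_arc_on E B \<Longrightarrow> single_arc_on (E \<inter> B \<times> B) B"
    unfolding single_arc_on_def by blast
  moreover have "complete_on E B \<Longrightarrow> complete_on (E \<inter> B \<times> B) B"
    by (simp add: complete_on_def)
  moreover have "directed_cycle_on E B \<Longrightarrow> directed_cycle_on (E \<inter> B \<times> B) B"
    by (simp add: directed_cycle_on_def Int_assoc)
  moreover have "symmetric_odd_cycle_on E B \<Longrightarrow> symmetric_odd_cycle_on (E \<inter> B \<times> B) B"
    by (simp add: symmetric_odd_cycle_on_def Int_assoc)
  ultimately show "gallai_block E B \<Longrightarrow> gallai_block (E \<inter> B \<times> B) B"
    unfolding gallai_block_def by blast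
qed

text \<open>Adding arcs between present vertices preserves nonseparability, so a maximal
  nonseparable subgraph already has all of them.\<close>

lemma is_block_induced:
  assumes "is_block B H"
  shows "subgraph B H" "arcs_ends B = arcs_ends H \<inter> verts B \<times> verts B" "nonseparable B"
proof -
  have max: "pre_digraph.max_subgraph H nonseparable B" using assms by (simp add: is_block_def)
  have "arc_mono nonseparable"
    unfolding arc_mono_def nonseparable_iff_nonseparable_set
    using arcs_ends_mono nonseparable_set_mono by metis
  then have ind: "induced_subgraph B H" using pre_digraph.induced_subgraphI_arc_mono[OF max] by blast
  then show "subgraph B H" by (rule induced_imp_subgraph)
  then have "tail B = tail H" "head B = head H"
    by (auto simp: subgraph_def compatible_def)
  then show "arcs_ends B = arcs_ends H \<inter> verts B \<times> verts B"
    using ind by (auto simp: induced_subgraph_def arcs_ends_conv)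
  show "nonseparable B" using max by (simp add: pre_digraph.max_subgraph_def)
qed

theorem theorem7p3:
  fixes G :: "('a, 'b) pre_digraph" and X :: "'a set" and L :: "'a \<Rightarrow> 'c set"
  assumes "digraph G"
    and "connected G"
    and "X \<subseteq> verts G"
    and "connected (G \<restriction> X)"
    and "list_dicolourable (G \<restriction> (verts G - X)) L"
    and "\<not> list_dicolourable G L"
    and "\<forall>x \<in> X. finite (L x) \<longrightarrow> card (L x) \<ge> d_max G x"
  shows "directed_gallai_forest (G \<restriction> X)"
proof -
  interpret digraph G by fact
  let ?E = "arcs_ends G"
  interpret uncolourable ?E "verts G" L X
  proof
    show "?E \<subseteq> verts G \<times> verts G" "(x, x) \<notin> ?E" for x
      using no_loops by (auto simp: arcs_ends_conv)
    show "\<not> dicolouring_on ?E L (verts G) \<phi>" for \<phi>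
      using assms(6) list_dicolouring_iff by (auto simp: list_dicolourable_def)
    show "card (?E `` {x}) \<le> card (L x)" "card (?E\<inverse> `` {x}) \<le> card (L x)"
      if "x \<in> X" "finite (L x)" for x
      using assms(7) that
      by (auto simp: d_max_def out_degree_eq_card in_degree_eq_card)
  qed (use assms(3) in simp_all)
  have con: "connected_set ?E X"
    using assms(4) by (simp add: connected_iff_connected_set arcs_ends_induce)
  obtain \<phi> where \<phi>: "dicolouring_on ?E L (verts G - X) \<phi>"
    using assms(5) list_dicolouring_induce[of "verts G - X"] by (auto simp: list_dicolourable_def)
  let ?H = "G \<restriction> X"
  have sub: "subgraph ?H G" using assms(3) by (rule subgraph_induce_subgraphI)
  interpret H: digraph ?H using sub by (rule digraph_subgraph)
  have "directed_gallai_tree ?H"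
    unfolding directed_gallai_tree_def
  proof (intro conjI allI impI)
    fix B assume "is_block B ?H"
    note B = is_block_induced[OF this]
    interpret B: digraph B using B(1) by (rule H.digraph_subgraph)
    have BX: "verts B \<subseteq> X" using B(1) by (auto simp: subgraph_def)
    then have ends: "arcs_ends B = ?E \<inter> verts B \<times> verts B"
      using B(2) by (auto simp: arcs_ends_induce)
    have "nonseparable_set ?E (verts B)"
      using B(3) ends nonseparable_set_mono by (metis nonseparable_iff_nonseparable_set Int_lower1)
    then have "gallai_block ?E (verts B)"
      using nonseparable_gallai_block[OF con \<phi> _ BX] by blast
    then show "single_arc B \<or> directed_cycle B \<or> symmetric_odd_cycle B \<or> complete_symmetric B"
      using B.gallai_block_digraph gallai_block_restrict ends by metis
  qed (use assms(4) H.digraph_axioms in simp_all)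
  \<comment> \<open>\<open>?H\<close> is connected, so by maximality it is its own only
    component.\<close>
  moreover have "C = ?H" if "is_component C ?H" for C
    using that assms(4) H.subgraph_refl
    unfolding is_component_def pre_digraph.max_subgraph_def by metis
  ultimately show ?thesis
    using H.digraph_axioms unfolding directed_gallai_forest_def by blast
qed

end
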